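(* Let $1\le j\le n-1$ and $0\le i\le rj-2$, and let $\omega_{i,j}=t^iy^{-j}dt$ be the corresponding element of the basis of $H^0(X_0,\Omega^1_{X_0})$. Let $d=\max\{0,\deg(v)-2p\}$, let $I_d\in k[t]$ be the inverse of $f$ at order $d+1$ (i.e. in $k[t]/(t^{d+1})$, so $f(t)I_d(t)=1+t^{d+1}P(t)$ with $P\in k[t]$), and let $a$ be the quotient and $b$ the remainder of the Euclidean division of $pj$ by $n$. Put $IP(t)=I_d(t)^{a+1}$, $d^\circ IP=\deg(IP)$, let $IP[k]$ be the coefficient of $t^k$ in $IP(t)$ and $v[m]$ the coefficient of $s^m$ in $v(s)$. Then $1\le b\le n-1$ and $$P_1\bigl(\Phi(\omega_{i,j})\bigr)=\overline{h(\omega'_{i,j})}=\sum_{m=1}^{r(n-b)-1}\left(\sum_{k=0}^{d^\circ IP}IP[k]\cdot v[p(i+2)+k+m]\right)\overline{t^{-m}y^{n-b}}$$ in $H^1(X_0,\mathcal O_{X_0})$.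
   Context: **Curve.** Let $p$ be a prime, $k$ a finite field of characteristic $p$, $W=W(k)$ its ring of Witt vectors, $W_1=W/p^2W$. Let $n\ge 1$ be an integer prime to $p$, $l\ge 1$ an integer with $l\equiv -1 \pmod n$ and $p\nmid l$, and $r=(l+1)/n$. Let $\mathbf f\in W[t]$ be a polynomial of degree $l$ such that $\mathbf f$ and its derivative $\mathbf f'$ generate the unit ideal of $W[t]$, and let $\mathbf f_2(s)=\mathbf f(1/s)s^{l+1}\in W[s]$. Write $f\in k[t]$, $f_2\in k[s]$ for their reductions modulo $p$; it is assumed that $\deg f=l$ and that $f(0)\neq 0$. $X$ is the curve over $\mathrm{Spec}(W)$ obtained by gluing $\mathrm{Spec}(W[t,y]/(y^n-\mathbf f(t)))$ and $\mathrm{Spec}(W[s,z]/(z^n-\mathbf f_2(s)))$ along $t\ne0$, $s\neq 0$ via $t=s^{-1}$, $z=s^ry$. Its special fibre $X_0$ over $k$ is the gluing of $\mathcal U=\mathrm{Spec}(k[t,y]/(y^n-f(t)))$ and $\mathcal V=\mathrm{Spec}(k[s,z]/(z^n-f_2(s)))$. Put $\overline{\mathcal U}=\mathcal U\cap D(y)$; then $X_0=\overline{\mathcal U}\cup\mathcal V$. Coefficients of a polynomial at indices that are negative or larger than the degree are $0$. **Bases.** $H^0(X_0,\Omega^1_{X_0})$ has $k$-basis $\omega_{i,j}=t^iy^{-j}dt$ ($1\le j\le n-1$, $0\le i\le rj-2$). $H^1(X_0,\mathcal O_{X_0})=\mathcal O_{X_0}(\overline{\mathcal U}\cap\mathcal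 V)/(\mathcal O_{X_0}(\overline{\mathcal U})+\mathcal O_{X_0}(\mathcal V))$ has $k$-basis the classes $\overline{h_{i,j}}$ of $h_{i,j}=t^{-i}y^j$ ($1\le j\le n-1$, $1\le i\le rj-1$); $\overline{x}$ denotes the class of $x\in \mathcal O_{X_0}(\overline{\mathcal U}\cap\mathcal V)$. **De Rham cohomology and splitting.** $H^1_{DR}(X_0)$ is the space of triples $(\omega_U,\omega_V,h)\in\Omega^1_{X_0}(\overline{\mathcal U})\oplus\Omega^1_{X_0}(\mathcal V)\oplus\mathcal O_{X_0}(\overline{\mathcal U}\cap\mathcal V)$ with $\omega_V-\omega_U+dh=0$ modulo triples $(dh_U,-dh_V,h_U+h_V)$, $h_U\in\mathcal O_{X_0}(\overline{\mathcal U})$, $h_V\in\mathcal O_{X_0}(\mathcal V)$; $[\cdot]$ denotes the class. Let $\lambda_m$ be the coefficient of $t^m$ in $f$. For $1\le j\le n-1$, $1\le i\le rj-1$ set $$\alpha^{\mathcal U}_{i,j}=\Bigl[\sum_{m=i+1}^l\tfrac{jm-in}{n}\lambda_mt^{m-(i+1)}\Bigr]y^{j-1}\tfrac{dt}{y^{n-1}},\qquad \alpha^{\mathcal V}_{i,j}=\Bigl[\sum_{m=0}^i\tfrac{in-jm}{n}\lambda_ms^{i+1+(n-j)r-2-m}\Bigr]z^{j-1}\tfrac{ds}{z^{n-1}},$$ so that $dh_{i,j}=\alpha^{\mathcal U}_{i,j}+\alpha^{\mathcal V}_{i,j}$; let $\tau$ be the $k$-linear map with $\tau(\overline{h_{i,j}})=(\alpha^{\mathcal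 U}_{i,j},-\alpha^{\mathcal V}_{i,j},h_{i,j})$. One identifies $H^0(X_0,\Omega^1_{X_0})\oplus H^1(X_0,\mathcal O_{X_0})$ with $H^1_{DR}(X_0)$ by $(\omega,x)\mapsto[(\omega|_{\overline{\mathcal U}},\omega|_{\mathcal V},0)]+[\tau(x)]$. $P_2$ (resp. $P_1$) is the projection to $H^0(X_0,\Omega^1_{X_0})$ (resp. $H^1(X_0,\mathcal O_{X_0})$). **Divided Frobenius $\Phi$.** Let $\sigma$ be the Frobenius of $k$ and its lift to $W$ and $W_1$; $Q^\sigma$ means $\sigma$ applied to the coefficients of $Q$; $X_0'$ is the base change of $X_0$ by $\sigma$ (given by $f^\sigma,f_2^\sigma$), with analogous bases $\omega'_{i,j}=t^iy^{-j}dt$, $\overline{h'_{i,j}}=\overline{t^{-i}y^j}$. For $x\in k[s]$, $px\in W_1[s]$ means $p$ times any lift of $x$. Fix $v,c\in k[s]$ with $\mathbf f_2(s)^p-\mathbf f_2^\sigma(s^p)=p\,(v(s)f_2'(s)^p-n\,c(s)f_2(s)^p)$ in $W_1[s]$; then $s\mapsto s^p+pv(s)$, $z\mapsto z^p+pz^pc(s)$ is a lift modulo $p^2$ of the relative Frobenius on $\mathcal V$, while on $\overline{\mathcal U}$ one uses the lift sending $t\mapsto t^p$ and $y\mapsto y^p+py^p\frac{\mathcal P(t)}{n}y^{-np}$, where $p\mathcal P(t)=\mathbf f^\sigma(t^p)-\mathbf f(t)^p$. The polynomial $v$ in the claim is this $v$. Let $F^\#$ be the $k$-linear relative Frobenius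 ($t\mapsto t^p$, $y\mapsto y^p$, $s\mapsto s^p$, $z\mapsto z^p$), and let $f_U,f_V,h$ be the $F^\#$-linear maps from $\Omega^1_{X'_0}$ (on $\overline{\mathcal U}'$, $\mathcal V'$, $\overline{\mathcal U}'\cap\mathcal V'$) to $\Omega^1_{X_0}(\overline{\mathcal U})$, $\Omega^1_{X_0}(\mathcal V)$, $\mathcal O_{X_0}(\overline{\mathcal U}\cap\mathcal V)$ with $f_U(dt)=t^{p-1}dt$, $f_V(ds)=(s^{p-1}+v'(s))ds$, $h(dt)=t^{2p}v(s)$; they satisfy $f_V-f_U+dh=0$. In particular $h(\omega'_{i,j})=t^{p(i+2)}y^{-pj}v(s)$ with $s=t^{-1}$. The Deligne–Illusie map $\Phi':H^0(X_0',\Omega^1_{X_0'})\oplus H^1(X'_0,\mathcal O_{X'_0})\to H^1_{DR}(X_0)$ is $\Phi'(\omega')=[(f_U(\omega'),f_V(\omega'),h(\omega'))]$, $\Phi'(\overline{x'})=[(0,0,F^\#(x'))]$. The divided Frobenius modulo $p$ is the $\sigma$-semilinear map $\Phi:H^0(X_0,\Omega^1_{X_0})\oplus H^1(X_0,\mathcal O_{X_0})\to H^1_{DR}(X_0)$ with $\Phi(\omega_{i,j})=\Phi'(\omega'_{i,j})$, $\Phi(\overline{h_{i,j}})=\Phi'(\overline{h'_{i,j}})$ (its coincidence with the crystalline divided Frobenius modulo $p$ is a cited theorem of Huyghe–Wach). *)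

theory Defs
  imports
    "HOL-Library.Poly_Mapping"
    "HOL-Library.Product_Plus"
    "HOL-Computational_Algebra.Computational_Algebra"
    "HOL-Number_Theory.Cong"
    "HOL-Algebra.Module"
begin

hide_const (open) Polynomial.smult

section \<open>Witt vectors\<close>

definition is_ring_hom :: "('a::comm_ring_1 \<Rightarrow> 'b::comm_ring_1) \<Rightarrow> bool" where
  "is_ring_hom \<phi> \<longleftrightarrow>
     \<phi> 1 = 1 \<and> (\<forall>x y. \<phi> (x + y) = \<phi> x + \<phi> y) \<and> (\<forall>x y. \<phi> (x * y) = \<phi> x * \<phi> y)"

text \<open>
  For a finite field \<open>k\<close> of characteristic \<open>p\<close> the ring \<open>W(k)\<close> is, up to unique isomorphism,
  the strict \<open>p\<close>-ring with residue ring \<open>k\<close> (Serre, Local Fields, II.5): \<open>p\<close> is not a zero divisor,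
  \<open>W\<close> is separated and complete for the \<open>p\<close>-adic topology, and \<open>red\<close> induces \<open>W/pW = k\<close>.
  The lift of Frobenius \<open>sig\<close> is the unique ring endomorphism inducing \<open>x \<mapsto> x^p\<close> on \<open>k\<close>.
\<close>

definition is_Witt_ring ::
  "nat \<Rightarrow> ('w::comm_ring_1 \<Rightarrow> 'k::finite_field) \<Rightarrow> ('w \<Rightarrow> 'w) \<Rightarrow> bool" where
  "is_Witt_ring p red sig \<longleftrightarrow>
     is_ring_hom red \<and> surj red \<and> (\<forall>x. red x = 0 \<longleftrightarrow> of_nat p dvd x) \<and>
     (\<forall>x :: 'w. of_nat p * x = 0 \<longrightarrow> x = 0) \<and>
     (\<forall>x :: 'w. (\<forall>m. of_nat p ^ m dvd x) \<longrightarrow> x = 0) \<and>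
     (\<forall>u :: nat \<Rightarrow> 'w. (\<forall>m. of_nat p ^ m dvd u (Suc m) - u m) \<longrightarrow>
        (\<exists>x. \<forall>m. of_nat p ^ m dvd x - u m)) \<and>
     is_ring_hom sig \<and> (\<forall>x. red (sig x) = red x ^ p)"

text \<open>
  \<open>times_p p red x A\<close>: the image of \<open>A\<close> in \<open>W\<^sub>1[s]\<close>, where \<open>W\<^sub>1 = W/p\<^sup>2W\<close>, is \<open>p x\<close>, that is \<open>p\<close>
  times any lift of \<open>x \<in> k[s]\<close> (two lifts of \<open>x\<close> differ by a multiple of \<open>p\<close>).
\<close>

definition times_p ::
  "nat \<Rightarrow> ('w::comm_ring_1 \<Rightarrow> 'k::finite_field) \<Rightarrow> 'k poly \<Rightarrow> 'w poly \<Rightarrow> bool" where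
  "times_p p red x A \<longleftrightarrow> (\<exists>G. map_poly red G = x \<and> of_nat (p\<^sup>2) dvd A - of_nat p * G)"

text \<open>\<open>s^(l+1) q(1/s)\<close>, for \<open>q\<close> of degree at most \<open>l\<close>.\<close>

definition at_infty :: "nat \<Rightarrow> 'a::comm_semiring_1 poly \<Rightarrow> 'a poly" where
  "at_infty l q = (\<Sum>m\<le>l. monom (coeff q m) (l + 1 - m))"


section \<open>Kaehler differentials\<close>

text \<open>
  \<open>'a \<Rightarrow>\<^sub>0 'a\<close> is the free module on symbols \<open>d b\<close>; the element \<open>a d b\<close> is
  \<open>Poly_Mapping.single b a\<close>.
  These are the absolute differentials. For an algebra over a finite field \<open>k\<close> they are the
  differentials relative to \<open>k\<close>, because \<open>d\<close> vanishes on \<open>k\<close> (\<open>dif_const\<close> below).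
\<close>

inductive_set kaehler_rel :: "('a::comm_ring_1 \<Rightarrow>\<^sub>0 'a) set" where
  zero: "0 \<in> kaehler_rel"
| diff: "x \<in> kaehler_rel \<Longrightarrow> y \<in> kaehler_rel \<Longrightarrow> x - y \<in> kaehler_rel"
| add: "Poly_Mapping.single (b + c) a - Poly_Mapping.single b a - Poly_Mapping.single c a
          \<in> kaehler_rel"
| leibniz: "Poly_Mapping.single (b * c) a - Poly_Mapping.single c (a * b)
          - Poly_Mapping.single b (a * c) \<in> kaehler_rel"

lemma kaehler_rel_minus: "x \<in> kaehler_rel \<Longrightarrow> - x \<in> kaehler_rel"
  using kaehler_rel.diff[OF kaehler_rel.zero] by fastforce

lemma kaehler_rel_plus: "x \<in> kaehler_rel \<Longrightarrow> y \<in> kaehler_rel \<Longrightarrow> x + y \<in> kaehler_rel"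
  using kaehler_rel.diff[OF _ kaehler_rel_minus] by fastforce

quotient_type (overloaded) 'a kaehler =
  "'a::comm_ring_1 \<Rightarrow>\<^sub>0 'a" / "\<lambda>x y. x - y \<in> kaehler_rel"
proof (rule equivpI)
  show "reflp (\<lambda>x y :: 'a \<Rightarrow>\<^sub>0 'a. x - y \<in> kaehler_rel)"
    by (rule reflpI) (simp add: kaehler_rel.zero)
  show "symp (\<lambda>x y :: 'a \<Rightarrow>\<^sub>0 'a. x - y \<in> kaehler_rel)"
    by (rule sympI) (metis kaehler_rel_minus minus_diff_eq)
  show "transp (\<lambda>x y :: 'a \<Rightarrow>\<^sub>0 'a. x - y \<in> kaehler_rel)"
    by (rule transpI) (metis kaehler_rel_plus diff_add_cancel add_diff_eq)
qed

instantiation kaehler :: (comm_ring_1) ab_group_add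
begin

lift_definition zero_kaehler :: "'a kaehler" is 0 .
lift_definition plus_kaehler :: "'a kaehler \<Rightarrow> 'a kaehler \<Rightarrow> 'a kaehler" is "(+)"
  using kaehler_rel_plus by (metis add_diff_add)
lift_definition uminus_kaehler :: "'a kaehler \<Rightarrow> 'a kaehler" is uminus
  using kaehler_rel_minus by fastforce
lift_definition minus_kaehler :: "'a kaehler \<Rightarrow> 'a kaehler \<Rightarrow> 'a kaehler" is "(-)"
  using kaehler_rel.diff
  by (metis (no_types, opaque_lifting) add_diff_add diff_conv_add_uminus minus_diff_minus)

instance
  by standard (transfer; simp add: kaehler_rel.zero algebra_simps)+

end

lift_definition dif :: "'a::comm_ring_1 \<Rightarrow> 'a kaehler" is "\<lambda>b. Poly_Mapping.single b 1" .

lemma map_mult_minus: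
  fixes a :: "'a::comm_ring_1" and x y :: "'a \<Rightarrow>\<^sub>0 'a"
  shows "Poly_Mapping.map ((*) a) (x - y) = Poly_Mapping.map ((*) a) x - Poly_Mapping.map ((*) a) y"
  by (rule poly_mapping_eqI)
     (auto simp: Poly_Mapping.map.rep_eq lookup_minus when_def right_diff_distrib)

lemma kaehler_rel_scale:
  "x \<in> kaehler_rel \<Longrightarrow> Poly_Mapping.map ((*) a) x \<in> kaehler_rel"
proof (induction rule: kaehler_rel.induct)
  case zero
  have "Poly_Mapping.map ((*) a) 0 = (0 :: 'a \<Rightarrow>\<^sub>0 'a)"
    by (rule poly_mapping_eqI) (simp add: Poly_Mapping.map.rep_eq)
  then show ?case by (simp add: kaehler_rel.zero)
next
  case (diff x y)
  then show ?case by (simp add: map_mult_minus kaehler_rel.diff)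
next
  case (add b c a')
  show ?case using kaehler_rel.add[of b c "a * a'"] by (simp add: map_mult_minus)
next
  case (leibniz b c a')
  show ?case using kaehler_rel.leibniz[of b c "a * a'"]
    by (simp add: map_mult_minus mult.assoc)
qed

lift_definition scale_form :: "'a::comm_ring_1 \<Rightarrow> 'a kaehler \<Rightarrow> 'a kaehler" (infixr \<open>*\<^sub>\<Omega>\<close> 75)
  is "\<lambda>a. Poly_Mapping.map ((*) a)"
  by (metis kaehler_rel_scale map_mult_minus)

lemma dif_mult: "dif (a * b) = a *\<^sub>\<Omega> dif b + b *\<^sub>\<Omega> dif (a :: 'a::comm_ring_1)"
proof (transfer)
  fix a b :: 'a
  show "Poly_Mapping.single (a * b) 1 - (Poly_Mapping.map ((*) a) (Poly_Mapping.single b 1)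
     + Poly_Mapping.map ((*) b) (Poly_Mapping.single a 1)) \<in> kaehler_rel"
    using kaehler_rel.leibniz[of a b 1] by (simp add: diff_diff_eq)
qed

lemma dif_add: "dif (a + b) = dif a + dif (b :: 'a::comm_ring_1)"
proof (transfer)
  fix a b :: 'a
  show "Poly_Mapping.single (a + b) 1 - (Poly_Mapping.single a 1
     + Poly_Mapping.single b 1) \<in> kaehler_rel"
    using kaehler_rel.add[of a b 1] by (simp add: diff_diff_eq)
qed

lemma map_mult_plus:
  fixes a :: "'a::comm_ring_1" and x y :: "'a \<Rightarrow>\<^sub>0 'a"
  shows "Poly_Mapping.map ((*) a) (x + y) = Poly_Mapping.map ((*) a) x + Poly_Mapping.map ((*) a) y"
  by (rule poly_mapping_eqI)
     (auto simp: Poly_Mapping.map.rep_eq lookup_add when_def simp flip: distrib_left)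

lemma scale_form_add_right: "a *\<^sub>\<Omega> (\<omega> + \<eta>) = a *\<^sub>\<Omega> \<omega> + a *\<^sub>\<Omega> \<eta>"
  by transfer (simp add: map_mult_plus kaehler_rel.zero)

lemma scale_form_add_left: "(a + b) *\<^sub>\<Omega> \<omega> = a *\<^sub>\<Omega> \<omega> + b *\<^sub>\<Omega> \<omega>"
proof transfer
  fix a b :: 'a and x :: "'a \<Rightarrow>\<^sub>0 'a"
  have "Poly_Mapping.map ((*) (a + b)) x =
      Poly_Mapping.map ((*) a) x + Poly_Mapping.map ((*) b) x"
    by (rule poly_mapping_eqI)
       (auto simp: Poly_Mapping.map.rep_eq lookup_add when_def distrib_right)
  then show "Poly_Mapping.map ((*) (a + b)) x -
      (Poly_Mapping.map ((*) a) x + Poly_Mapping.map ((*) b) x) \<in> kaehler_rel"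
    by (simp add: kaehler_rel.zero)
qed

lemma scale_form_scale: "a *\<^sub>\<Omega> (b *\<^sub>\<Omega> \<omega>) = (a * b) *\<^sub>\<Omega> \<omega>"
proof transfer
  fix a b :: 'a and x :: "'a \<Rightarrow>\<^sub>0 'a"
  have "Poly_Mapping.map ((*) a) (Poly_Mapping.map ((*) b) x) = Poly_Mapping.map ((*) (a * b)) x"
    by (rule poly_mapping_eqI) (auto simp: Poly_Mapping.map.rep_eq when_def mult.assoc)
  then show "Poly_Mapping.map ((*) a) (Poly_Mapping.map ((*) b) x) -
      Poly_Mapping.map ((*) (a * b)) x \<in> kaehler_rel"
    by (simp add: kaehler_rel.zero)
qed

lemma scale_form_one [simp]: "1 *\<^sub>\<Omega> \<omega> = \<omega>"
proof transfer
  fix x :: "'a \<Rightarrow>\<^sub>0 'a"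
  have "Poly_Mapping.map ((*) 1) x = x"
    by (rule poly_mapping_eqI) (auto simp: Poly_Mapping.map.rep_eq when_def)
  then show "Poly_Mapping.map ((*) 1) x - x \<in> kaehler_rel"
    by (simp add: kaehler_rel.zero)
qed

lemma scale_form_zero_left [simp]: "0 *\<^sub>\<Omega> \<omega> = 0"
  using scale_form_add_left[of 0 0 \<omega>] by simp

lemma dif_one: "dif (1 :: 'a::comm_ring_1) = 0"
  using dif_mult[of 1 "1 :: 'a"] by simp

lemma dif_power_Suc:
  "dif (a ^ Suc m) = (of_nat (Suc m) * a ^ m) *\<^sub>\<Omega> dif (a :: 'a::comm_ring_1)"
proof (induction m)
  case 0
  then show ?case by simp
next
  case (Suc m)
  have "dif (a ^ Suc (Suc m)) = a *\<^sub>\<Omega> dif (a ^ Suc m) + a ^ Suc m *\<^sub>\<Omega> dif a"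
    by (metis dif_mult power_Suc)
  also have "\<dots> = (a * (of_nat (Suc m) * a ^ m) + a ^ Suc m) *\<^sub>\<Omega> dif a"
    by (simp only: Suc scale_form_scale scale_form_add_left)
  also have "a * (of_nat (Suc m) * a ^ m) + a ^ Suc m = of_nat (Suc (Suc m)) * a ^ Suc m"
    by (simp add: algebra_simps)
  finally show ?case .
qed

lemma dif_const:
  fixes \<phi> :: "'k::finite_field \<Rightarrow> 'a::comm_ring_1"
  assumes "is_ring_hom \<phi>"
  shows "dif (\<phi> x) = 0"
proof -
  define q where "q = card (UNIV :: 'k set)"
  have pow: "\<phi> (x ^ m) = \<phi> x ^ m" for m
    using assms by (induction m) (auto simp: is_ring_hom_def)
  have "\<phi> 0 = 0"
    using assms unfolding is_ring_hom_def by (metis add_cancel_right_right)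
  then have nat: "\<phi> (of_nat m) = of_nat m" for m
    using assms by (induction m) (auto simp: is_ring_hom_def)
  have "(of_nat q :: 'k) = 0"
  proof -
    have "(\<Sum>u::'k\<in>UNIV. u + 1) = (\<Sum>u\<in>UNIV. u)"
      by (rule sum.reindex_bij_witness[of _ "\<lambda>u. u - 1" "\<lambda>u. u + 1"]) auto
    then show ?thesis by (simp add: sum.distrib q_def)
  qed
  then have q0: "(of_nat q :: 'a) = 0"
    using nat[of q] \<open>\<phi> 0 = 0\<close> by simp
  obtain m where m: "q = Suc m"
    using finite_UNIV_card_ge_0[where ?'a = 'k] unfolding q_def by (auto simp: gr0_conv_Suc)
  have "\<phi> x = \<phi> x ^ q"
    using finite_field_power_card_eq_same[of x] pow[of q] by (simp add: q_def)
  then have "dif (\<phi> x) = (of_nat q * \<phi> x ^ m) *\<^sub>\<Omega> dif (\<phi> x)"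
    using dif_power_Suc[of "\<phi> x" m] m by simp
  then show ?thesis by (simp add: q0)
qed

text \<open>
  \<open>forms A\<close> is the \<open>A\<close>-submodule of \<open>\<Omega>\<close> spanned by \<open>dA\<close>. When \<open>A\<close> is the ring of an affine open of a
  smooth integral curve with function field \<open>'a\<close>, the module of differentials of \<open>A\<close> over \<open>k\<close> is
  locally free, so it injects into the differentials of the function field with image \<open>forms A\<close>.
\<close>

definition forms :: "'a::comm_ring_1 set \<Rightarrow> 'a kaehler set" where
  "forms A = {(\<Sum>(a, b)\<leftarrow>xs. a *\<^sub>\<Omega> dif b) | xs. set xs \<subseteq> A \<times> A}"


section \<open>Quotient vector spaces\<close>

definition coset :: "'v::ab_group_add set \<Rightarrow> 'v \<Rightarrow> 'v set" where
  "coset B x = {x + b | b. b \<in> B}"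

text \<open>
  \<open>Z / B\<close> for subspaces \<open>B \<subseteq> Z\<close>. The fields \<open>mult\<close> and \<open>one\<close> of the record play no role
  in a module.
\<close>

definition quot_space ::
  "('k \<Rightarrow> 'v \<Rightarrow> 'v) \<Rightarrow> 'v::ab_group_add set \<Rightarrow> 'v set \<Rightarrow> ('k, 'v set) module" where
  "quot_space sc Z B =
     \<lparr>carrier = coset B ` Z, mult = (\<lambda>X Y. undefined), one = undefined,
      zero = B, add = (\<lambda>X Y. {x + y | x y. x \<in> X \<and> y \<in> Y}),
      smult = (\<lambda>c X. {sc c x + b | x b. x \<in> X \<and> b \<in> B})\<rparr>"


section \<open>The curve\<close>

text \<open>
  The curve is integral and \<open>'K\<close> is its function field, so that all rings of sections are subrings
  of \<open>'K\<close> and restriction maps are inclusions; \<open>cst\<close> is the inclusion of the base field.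
\<close>

record (overloaded) ('k, 'K) superell =
  expo :: nat
  rr :: nat
  fpol :: "'k poly"
  cst :: "'k \<Rightarrow> 'K"
  tt :: 'K
  yy :: 'K

definition ss :: "('k, 'K::field) superell \<Rightarrow> 'K" where
  "ss C = inverse (tt C)"

definition zz :: "('k, 'K::field) superell \<Rightarrow> 'K" where
  "zz C = ss C ^ rr C * yy C"

definition ev :: "('k::field, 'K::field) superell \<Rightarrow> 'k poly \<Rightarrow> 'K \<Rightarrow> 'K" where
  "ev C q a = poly (map_poly (cst C) q) a"

text \<open>In \<open>'k poly poly\<close> the inner variable is \<open>t\<close> (or \<open>s\<close>), the outer one \<open>y\<close> (or \<open>z\<close>).\<close>

definition ev2 :: "('k::field, 'K::field) superell \<Rightarrow> 'k poly poly \<Rightarrow> 'K \<Rightarrow> 'K \<Rightarrow> 'K" where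
  "ev2 C Q a b = poly (map_poly (\<lambda>q. ev C q a) Q) b"

text \<open>
  The two kernel conditions say that \<open>k[t,y]\<close> and \<open>k[s,z]\<close>, as subrings of \<open>'K\<close>, are
  \<open>k[t,y]/(y^n - f(t))\<close> and \<open>k[s,z]/(z^n - f\<^sub>2(s))\<close>; the gluing is \<open>t = 1/s\<close>, \<open>z = s^r y\<close>.
\<close>

definition is_curve :: "('k::field, 'K::field) superell \<Rightarrow> bool" where
  "is_curve C \<longleftrightarrow>
     is_ring_hom (cst C) \<and>
     (\<forall>Q. ev2 C Q (tt C) (yy C) = 0 \<longleftrightarrow> monom 1 (expo C) - [:fpol C:] dvd Q) \<and>
     (\<forall>Q. ev2 C Q (ss C) (zz C) = 0 \<longleftrightarrow>
        monom 1 (expo C) - [:at_infty (degree (fpol C)) (fpol C):] dvd Q) \<and>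
     (\<forall>g. \<exists>Q R. ev2 C R (tt C) (yy C) \<noteq> 0 \<and>
        g = ev2 C Q (tt C) (yy C) / ev2 C R (tt C) (yy C))"

definition O_Ubar :: "('k::field, 'K::field) superell \<Rightarrow> 'K set" where
  "O_Ubar C = {ev2 C Q (tt C) (yy C) / yy C ^ N | Q N. True}"

definition O_V :: "('k::field, 'K::field) superell \<Rightarrow> 'K set" where
  "O_V C = {ev2 C Q (ss C) (zz C) | Q. True}"

definition O_UV :: "('k::field, 'K::field) superell \<Rightarrow> 'K set" where
  "O_UV C = {ev2 C Q (tt C) (yy C) / (tt C * yy C) ^ N | Q N. True}"

definition H0 :: "('k::field, 'K::field) superell \<Rightarrow> 'K kaehler set" where
  "H0 C = forms (O_Ubar C) \<inter> forms (O_V C)"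

definition H1 :: "('k::field, 'K::field) superell \<Rightarrow> ('k, 'K set) module" where
  "H1 C = quot_space (\<lambda>a g. cst C a * g) (O_UV C) {g + h | g h. g \<in> O_Ubar C \<and> h \<in> O_V C}"

definition cls1 :: "('k::field, 'K::field) superell \<Rightarrow> 'K \<Rightarrow> 'K set" where
  "cls1 C = coset {g + h | g h. g \<in> O_Ubar C \<and> h \<in> O_V C}"

definition bas_om :: "('k::field, 'K::field) superell \<Rightarrow> nat \<Rightarrow> nat \<Rightarrow> 'K kaehler" where
  "bas_om C i j = (tt C ^ i / yy C ^ j) *\<^sub>\<Omega> dif (tt C)"

definition bas_h :: "('k::field, 'K::field) superell \<Rightarrow> nat \<Rightarrow> nat \<Rightarrow> 'K" where
  "bas_h C i j = yy C ^ j / tt C ^ i"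


section \<open>De Rham cohomology and its splitting\<close>

type_synonym 'K triple = "'K kaehler \<times> 'K kaehler \<times> 'K"

definition scale_triple :: "('k::field, 'K::field) superell \<Rightarrow> 'k \<Rightarrow> 'K triple \<Rightarrow> 'K triple" where
  "scale_triple C a = (\<lambda>(\<omega>U, \<omega>V, g). (cst C a *\<^sub>\<Omega> \<omega>U, cst C a *\<^sub>\<Omega> \<omega>V, cst C a * g))"

definition Z_DR :: "('k::field, 'K::field) superell \<Rightarrow> 'K triple set" where
  "Z_DR C = {(\<omega>U, \<omega>V, g). \<omega>U \<in> forms (O_Ubar C) \<and> \<omega>V \<in> forms (O_V C) \<and> g \<in> O_UV C \<and>
     \<omega>V - \<omega>U + dif g = 0}"

definition B_DR :: "('k::field, 'K::field) superell \<Rightarrow> 'K triple set" where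
  "B_DR C = {(dif gU, - dif gV, gU + gV) | gU gV. gU \<in> O_Ubar C \<and> gV \<in> O_V C}"

definition H1_DR :: "('k::field, 'K::field) superell \<Rightarrow> ('k, 'K triple set) module" where
  "H1_DR C = quot_space (scale_triple C) (Z_DR C) (B_DR C)"

definition cls_DR :: "('k::field, 'K::field) superell \<Rightarrow> 'K triple \<Rightarrow> 'K triple set" where
  "cls_DR C = coset (B_DR C)"

text \<open>
  For \<open>1 \<le> j < n\<close> and \<open>r \<ge> 1\<close> the exponents of \<open>t\<close> and \<open>s\<close> below are nonnegative integers, so
  subtraction on \<open>nat\<close> does not truncate.
\<close>

definition alpha_U :: "('k::field, 'K::field) superell \<Rightarrow> nat \<Rightarrow> nat \<Rightarrow> 'K kaehler" where
  "alpha_U C i j =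
     ((\<Sum>m=i+1..degree (fpol C).
         cst C ((of_nat (j * m) - of_nat (i * expo C)) / of_nat (expo C) * coeff (fpol C) m)
         * tt C ^ (m - (i + 1)))
       * yy C ^ (j - 1) / yy C ^ (expo C - 1)) *\<^sub>\<Omega> dif (tt C)"

definition alpha_V :: "('k::field, 'K::field) superell \<Rightarrow> nat \<Rightarrow> nat \<Rightarrow> 'K kaehler" where
  "alpha_V C i j =
     ((\<Sum>m=0..i.
         cst C ((of_nat (i * expo C) - of_nat (j * m)) / of_nat (expo C) * coeff (fpol C) m)
         * ss C ^ (i + 1 + (expo C - j) * rr C - 2 - m))
       * zz C ^ (j - 1) / zz C ^ (expo C - 1)) *\<^sub>\<Omega> dif (ss C)"

definition is_tau ::
  "('k::field, 'K::field) superell \<Rightarrow> ('K set \<Rightarrow> 'K triple) \<Rightarrow> bool" where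
  "is_tau C \<tau> \<longleftrightarrow>
     (\<forall>X\<in>carrier (H1 C). \<forall>Y\<in>carrier (H1 C). \<tau> (X \<oplus>\<^bsub>H1 C\<^esub> Y) = \<tau> X + \<tau> Y) \<and>
     (\<forall>a. \<forall>X\<in>carrier (H1 C). \<tau> (a \<odot>\<^bsub>H1 C\<^esub> X) = scale_triple C a (\<tau> X)) \<and>
     (\<forall>i j. 1 \<le> j \<and> j \<le> expo C - 1 \<and> 1 \<le> i \<and> i \<le> rr C * j - 1 \<longrightarrow>
        \<tau> (cls1 C (bas_h C i j)) = (alpha_U C i j, - alpha_V C i j, bas_h C i j))"

definition identify ::
  "('k::field, 'K::field) superell \<Rightarrow> ('K set \<Rightarrow> 'K triple) \<Rightarrow> 'K kaehler \<times> 'K set \<Rightarrow> 'K triple set"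
  where
  "identify C \<tau> = (\<lambda>(\<omega>, X). cls_DR C (\<omega>, \<omega>, 0) \<oplus>\<^bsub>H1_DR C\<^esub> cls_DR C (\<tau> X))"

definition P1 ::
  "('k::field, 'K::field) superell \<Rightarrow> ('K set \<Rightarrow> 'K triple) \<Rightarrow> 'K triple set \<Rightarrow> 'K set" where
  "P1 C \<tau> \<xi> = snd (inv_into (H0 C \<times> carrier (H1 C)) (identify C \<tau>) \<xi>)"


section \<open>The divided Frobenius\<close>

text \<open>In this section \<open>C'\<close> is the Frobenius twist of \<open>C\<close>.\<close>

definition is_rel_Frobenius ::
  "nat \<Rightarrow> ('k::field, 'L::field) superell \<Rightarrow> ('k, 'K::field) superell \<Rightarrow> ('L \<Rightarrow> 'K) \<Rightarrow> bool" where
  "is_rel_Frobenius p C' C F \<longleftrightarrow>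
     is_ring_hom F \<and> (\<forall>a. F (cst C' a) = cst C a) \<and>
     F (tt C') = tt C ^ p \<and> F (yy C') = yy C ^ p"

definition semilinear_on ::
  "('L \<Rightarrow> 'K) \<Rightarrow> ('K \<Rightarrow> 'v \<Rightarrow> 'v) \<Rightarrow> 'L::field set \<Rightarrow> ('L kaehler \<Rightarrow> 'v::ab_group_add) \<Rightarrow> bool" where
  "semilinear_on F sc A \<phi> \<longleftrightarrow>
     (\<forall>\<omega>\<in>forms A. \<forall>\<omega>'\<in>forms A. \<phi> (\<omega> + \<omega>') = \<phi> \<omega> + \<phi> \<omega>') \<and>
     (\<forall>a\<in>A. \<forall>\<omega>\<in>forms A. \<phi> (a *\<^sub>\<Omega> \<omega>) = sc (F a) (\<phi> \<omega>))"

definition are_DI_maps ::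
  "nat \<Rightarrow> 'k poly \<Rightarrow> ('k::field, 'L::field) superell \<Rightarrow> ('k, 'K::field) superell \<Rightarrow> ('L \<Rightarrow> 'K) \<Rightarrow>
   ('L kaehler \<Rightarrow> 'K kaehler) \<Rightarrow> ('L kaehler \<Rightarrow> 'K kaehler) \<Rightarrow> ('L kaehler \<Rightarrow> 'K) \<Rightarrow> bool" where
  "are_DI_maps p v C' C F fU fV h \<longleftrightarrow>
     fU ` forms (O_Ubar C') \<subseteq> forms (O_Ubar C) \<and> semilinear_on F (*\<^sub>\<Omega>) (O_Ubar C') fU \<and>
     fV ` forms (O_V C') \<subseteq> forms (O_V C) \<and> semilinear_on F (*\<^sub>\<Omega>) (O_V C') fV \<and>
     h ` forms (O_UV C') \<subseteq> O_UV C \<and> semilinear_on F (*) (O_UV C') h \<and>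
     fU (dif (tt C')) = tt C ^ (p - 1) *\<^sub>\<Omega> dif (tt C) \<and>
     fV (dif (ss C')) = (ss C ^ (p - 1) + ev C (pderiv v) (ss C)) *\<^sub>\<Omega> dif (ss C) \<and>
     h (dif (tt C')) = tt C ^ (2 * p) * ev C v (ss C)"

text \<open>The Deligne--Illusie map \<open>\<Phi>'\<close>; the class does not depend on the representative of \<open>X\<close>.\<close>

definition DI_map ::
  "('k::field, 'K::field) superell \<Rightarrow> ('L \<Rightarrow> 'K) \<Rightarrow> ('L::field kaehler \<Rightarrow> 'K kaehler) \<Rightarrow>
   ('L kaehler \<Rightarrow> 'K kaehler) \<Rightarrow> ('L kaehler \<Rightarrow> 'K) \<Rightarrow> 'L kaehler \<times> 'L set \<Rightarrow> 'K triple set" where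
  "DI_map C F fU fV h = (\<lambda>(\<omega>, X).
     cls_DR C (fU \<omega>, fV \<omega>, h \<omega>) \<oplus>\<^bsub>H1_DR C\<^esub> cls_DR C (0, 0, F (SOME g. g \<in> X)))"

definition is_divided_Frobenius ::
  "nat \<Rightarrow> ('k::field, 'L::field) superell \<Rightarrow> ('k, 'K::field) superell \<Rightarrow>
   ('L kaehler \<times> 'L set \<Rightarrow> 'K triple set) \<Rightarrow> ('K kaehler \<times> 'K set \<Rightarrow> 'K triple set) \<Rightarrow> bool" where
  "is_divided_Frobenius p C' C \<Phi>' \<Phi> \<longleftrightarrow>
     (\<forall>\<omega>\<in>H0 C. \<forall>\<eta>\<in>H0 C. \<forall>X\<in>carrier (H1 C). \<forall>Y\<in>carrier (H1 C).
        \<Phi> (\<omega> + \<eta>, X \<oplus>\<^bsub>H1 C\<^esub> Y) = \<Phi> (\<omega>, X) \<oplus>\<^bsub>H1_DR C\<^esub> \<Phi> (\<eta>, Y)) \<and>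
     (\<forall>a. \<forall>\<omega>\<in>H0 C. \<forall>X\<in>carrier (H1 C).
        \<Phi> (cst C a *\<^sub>\<Omega> \<omega>, a \<odot>\<^bsub>H1 C\<^esub> X) = a ^ p \<odot>\<^bsub>H1_DR C\<^esub> \<Phi> (\<omega>, X)) \<and>
     (\<forall>i j. 1 \<le> j \<and> j \<le> expo C - 1 \<and> i + 2 \<le> rr C * j \<longrightarrow>
        \<Phi> (bas_om C i j, \<zero>\<^bsub>H1 C\<^esub>) = \<Phi>' (bas_om C' i j, \<zero>\<^bsub>H1 C'\<^esub>)) \<and>
     (\<forall>i j. 1 \<le> j \<and> j \<le> expo C - 1 \<and> 1 \<le> i \<and> i \<le> rr C * j - 1 \<longrightarrow>
        \<Phi> (0, cls1 C (bas_h C i j)) = \<Phi>' (0, cls1 C' (bas_h C' i j)))"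

end

theory Submission
  imports Defs
begin

text \<open>
  Two things have to be shown: that the projection \<open>P\<^sub>1\<close> of the class of \<open>(f\<^sub>U \<omega>', f\<^sub>V \<omega>', h \<omega>')\<close> is the
  class of its last component, and that this last component has the stated expansion in the
  basis \<open>t\<^bsup>-m\<^esup> y\<^sup>j\<close>. Here and below \<open>\<U>\<close> denotes the chart on which \<open>y\<close> is invertible.

  The projection \<open>P\<^sub>1\<close> is defined by inverting the identification of \<open>H\<^sup>0 \<oplus> H\<^sup>1\<close> with de Rham
  cohomology. The functions on \<open>\<U> \<inter> \<V>\<close> are spanned by functions on \<open>\<U>\<close>, functions on \<open>\<V>\<close> and the
  \<open>t\<^bsup>-i\<^esup> y\<^sup>j\<close> (\<open>O_UV_induct\<close>, a partial fraction argument). Together with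
  \<open>d(t\<^bsup>-i\<^esup> y\<^sup>j) = \<alpha>\<^sup>U + \<alpha>\<^sup>V\<close> (\<open>dif_bas_h\<close>) this shows that \<open>\<tau>\<close> lifts every class of functions to a
  de Rham cocycle with the same last component (\<open>tau_section\<close>), and hence that \<open>P\<^sub>1\<close> reads off the
  class of the last component of any cocycle (\<open>P1_cls_DR\<close>). The triple in question is a cocycle
  because the derivation kills \<open>p\<close>-th powers (\<open>DI_cocycle\<close>). That the forms involved are regular on
  \<open>\<V>\<close> comes down to \<open>z\<^bsup>-(n-1)\<^esup> ds\<close> (\<open>omega_inf_V\<close>); here the separability of \<open>f\<close> enters.

  For the expansion, write \<open>p j = n a + b\<close>. Then \<open>h(\<omega>') = t\<^bsup>p(i+2)\<^esup> v(1/t) y\<^bsup>-pj\<^esup>\<close>, and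
  \<open>y\<^bsup>-pj\<^esup> = f\<^bsup>-(a+1)\<^esup> y\<^bsup>n-b\<^esup>\<close>. Modulo functions on \<open>\<U>\<close> the inverse of \<open>f\<close> may be replaced by the
  polynomial \<open>I\<^sub>d\<close>, because the error is divisible by \<open>t\<^bsup>d+1\<^esup>\<close> and \<open>deg v \<le> 2 p + d\<close>. Of the remaining
  monomials \<open>t\<^bsup>-m\<^esup> y\<^bsup>n-b\<^esup>\<close>, those with \<open>m \<le> 0\<close> are regular on \<open>\<U>\<close> and those with \<open>m \<ge> r (n - b)\<close>
  are regular on \<open>\<V>\<close> (\<open>cls1_expansion\<close>). Finally \<open>b > 0\<close>, because \<open>n\<close> is prime to \<open>p\<close> and \<open>0 < j < n\<close>.
\<close>


section \<open>Ring homomorphisms and polynomial evaluation\<close>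

lemma hom_zero: "is_ring_hom \<phi> \<Longrightarrow> \<phi> 0 = 0"
  unfolding is_ring_hom_def by (metis add_cancel_right_right)

lemma hom_one: "is_ring_hom \<phi> \<Longrightarrow> \<phi> 1 = 1"
  and hom_add: "is_ring_hom \<phi> \<Longrightarrow> \<phi> (x + y) = \<phi> x + \<phi> y"
  and hom_mult: "is_ring_hom \<phi> \<Longrightarrow> \<phi> (x * y) = \<phi> x * \<phi> y"
  by (auto simp: is_ring_hom_def)

lemma hom_minus: "is_ring_hom \<phi> \<Longrightarrow> \<phi> (- x) = - \<phi> x"
  using hom_add[of \<phi> x "- x"] by (simp add: hom_zero add_eq_0_iff)

lemma hom_diff: "is_ring_hom \<phi> \<Longrightarrow> \<phi> (x - y) = \<phi> x - \<phi> y"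
  using hom_add[of \<phi> x "- y"] by (simp add: hom_minus)

lemma hom_power: "is_ring_hom \<phi> \<Longrightarrow> \<phi> (x ^ m) = \<phi> x ^ m"
  by (induction m) (auto simp: hom_one hom_mult)

lemma hom_of_nat: "is_ring_hom \<phi> \<Longrightarrow> \<phi> (of_nat m) = of_nat m"
  by (induction m) (auto simp: hom_one hom_add hom_zero)

lemma hom_sum: "is_ring_hom \<phi> \<Longrightarrow> \<phi> (\<Sum>x\<in>S. g x) = (\<Sum>x\<in>S. \<phi> (g x))"
  by (induction S rule: infinite_finite_induct) (auto simp: hom_zero hom_add)

lemmas homs = hom_zero hom_one hom_add hom_mult hom_minus hom_diff hom_power hom_of_nat hom_sum

lemma hom_nonzero:
  fixes \<phi> :: "'a::field \<Rightarrow> 'b::field"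
  assumes "is_ring_hom \<phi>" "x \<noteq> 0"
  shows "\<phi> x \<noteq> 0"
  using hom_mult[OF assms(1), of x "inverse x"] assms by (auto simp: hom_one)

lemma hom_divide:
  fixes \<phi> :: "'a::field \<Rightarrow> 'b::field"
  assumes "is_ring_hom \<phi>"
  shows "\<phi> (x / y) = \<phi> x / \<phi> y"
proof (cases "y = 0")
  case True
  then show ?thesis by (simp add: hom_zero[OF assms])
next
  case False
  then show ?thesis
    using hom_nonzero[OF assms False] hom_mult[OF assms, of "x / y" y] by (simp add: field_simps)
qed

lemma hom_map_poly: "is_ring_hom \<phi> \<Longrightarrow> is_ring_hom (map_poly \<phi>)"
  unfolding is_ring_hom_def[of "map_poly \<phi>"]
  by (auto intro!: poly_eqI simp: coeff_map_poly homs coeff_mult coeff_1)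

lemma hom_poly: "is_ring_hom (\<lambda>q. poly q a)"
  by (simp add: is_ring_hom_def)

lemma hom_comp: "is_ring_hom \<phi> \<Longrightarrow> is_ring_hom \<psi> \<Longrightarrow> is_ring_hom (\<lambda>x. \<psi> (\<phi> x))"
  by (simp add: is_ring_hom_def)

lemma hom_eval: "is_ring_hom \<phi> \<Longrightarrow> is_ring_hom (\<lambda>q. poly (map_poly \<phi> q) a)"
  by (rule hom_comp[OF hom_map_poly hom_poly])

lemma map_poly_pderiv:
  assumes "is_ring_hom \<phi>"
  shows "map_poly \<phi> (pderiv q) = pderiv (map_poly \<phi> q)"
  by (rule poly_eqI) (simp add: coeff_map_poly coeff_pderiv homs[OF assms])

text \<open>Raise \<open>x A + w B = 1\<close> to the power \<open>N\<close>: all terms of the expansion but one contain \<open>x\<close>.\<close>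

lemma bezout_power_right:
  fixes x w :: "'a::comm_ring_1"
  assumes "x * A + w * B = 1"
  shows "\<exists>A' B'. x * A' + w ^ N * B' = 1"
proof (induction N)
  case 0
  then show ?case by (intro exI[of _ 0] exI[of _ 1]) simp
next
  case (Suc N)
  then obtain A' B' where "x * A' + w ^ N * B' = 1" by blast
  then have "(x * A' + w ^ N * B') * (x * A + w * B) = 1"
    using assms by simp
  then have "x * (A' * (x * A + w * B) + w ^ N * B' * A) + w ^ Suc N * (B' * B) = 1"
    by (simp add: algebra_simps)
  then show ?case by blast
qed

lemma bezout_powers:
  fixes x w :: "'a::comm_ring_1"
  assumes "x * A + w * B = 1"
  shows "\<exists>A' B'. x ^ M * A' + w ^ N * B' = 1"
proof -
  obtain A1 B1 where "x * A1 + w ^ N * B1 = 1"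
    using bezout_power_right[OF assms] by blast
  then have "w ^ N * B1 + x * A1 = 1" by (simp add: add.commute)
  from bezout_power_right[OF this, of M] show ?thesis
    by (metis add.commute)
qed

text \<open>A polynomial differs from its constant term by a multiple of the variable.\<close>

lemma bezout_X:
  fixes q :: "'a::field poly"
  assumes "coeff q 0 \<noteq> 0"
  shows "\<exists>A B. q * A + [:0, 1:] * B = 1"
proof -
  obtain c E where q: "q = pCons c E" by (cases q)
  with assms have "c \<noteq> 0" by simp
  have "q * [:inverse c:] + [:0, 1:] * (Polynomial.smult (- inverse c) E) = 1"
    using \<open>c \<noteq> 0\<close> by (simp add: q one_pCons)
  then show ?thesis by blast
qed


section \<open>Differential forms\<close>

lemma scale_form_zero_right [simp]: "a *\<^sub>\<Omega> 0 = (0 :: 'a::comm_ring_1 kaehler)"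
  using scale_form_add_right[of a 0 0] by simp

lemma scale_form_minus_right: "a *\<^sub>\<Omega> (- \<omega>) = - (a *\<^sub>\<Omega> \<omega>)"
  using scale_form_add_right[of a \<omega> "- \<omega>"] by (simp add: add_eq_0_iff)

lemma scale_form_minus_left: "(- a) *\<^sub>\<Omega> \<omega> = - (a *\<^sub>\<Omega> \<omega>)"
  using scale_form_add_left[of a "- a" \<omega>] by (simp add: add_eq_0_iff)

lemma dif_zero [simp]: "dif (0 :: 'a::comm_ring_1) = 0"
  using dif_add[of 0 "0 :: 'a"] by simp

lemma dif_minus: "dif (- a) = - dif (a :: 'a::comm_ring_1)"
  using dif_add[of a "- a"] by (simp add: add_eq_0_iff)

lemma dif_diff: "dif (a - b) = dif a - dif (b :: 'a::comm_ring_1)"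
  using dif_add[of a "- b"] by (simp add: dif_minus)

lemma dif_power: "dif (a ^ m) = (of_nat m * a ^ (m - 1)) *\<^sub>\<Omega> dif (a :: 'a::comm_ring_1)"
  by (cases m) (simp_all add: dif_one dif_power_Suc del: power_Suc of_nat_Suc)

lemma dif_inverse:
  fixes a :: "'a::field"
  assumes "a \<noteq> 0"
  shows "dif (inverse a) = (- (inverse a ^ 2)) *\<^sub>\<Omega> dif a"
proof -
  have "a *\<^sub>\<Omega> dif (inverse a) + inverse a *\<^sub>\<Omega> dif a = 0"
    using dif_mult[of a "inverse a"] assms by (simp add: dif_one)
  then have "inverse a *\<^sub>\<Omega> (a *\<^sub>\<Omega> dif (inverse a) + inverse a *\<^sub>\<Omega> dif a) = 0"
    by simp
  then show ?thesis
    using assms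
    by (simp add: scale_form_add_right scale_form_scale power2_eq_square scale_form_minus_left
        eq_neg_iff_add_eq_0)
qed

text \<open>
  The image of the relative Frobenius consists of expressions in \<open>p\<close>-th powers, so the derivation
  is linear over it: \<open>d(F(g) v(s)) = F(g) v'(s) ds\<close>.
\<close>

lemma dif_p_power:
  fixes a :: "'a::comm_ring_1"
  assumes "(of_nat p :: 'a) = 0"
  shows "dif (a ^ (p * m)) = 0"
  using assms by (simp add: dif_power)


section \<open>Subgroups and quotient spaces\<close>

definition subgroup_of :: "'v::ab_group_add set \<Rightarrow> bool" where
  "subgroup_of B \<longleftrightarrow> 0 \<in> B \<and> (\<forall>x\<in>B. \<forall>y\<in>B. x + y \<in> B) \<and> (\<forall>x\<in>B. - x \<in> B)"

lemma subgroup_ofI: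
  "0 \<in> B \<Longrightarrow> (\<And>x y. x \<in> B \<Longrightarrow> y \<in> B \<Longrightarrow> x + y \<in> B) \<Longrightarrow> (\<And>x. x \<in> B \<Longrightarrow> - x \<in> B) \<Longrightarrow> subgroup_of B"
  by (simp add: subgroup_of_def)

lemma subgroup_of_zero: "subgroup_of B \<Longrightarrow> 0 \<in> B"
  and subgroup_of_add: "subgroup_of B \<Longrightarrow> x \<in> B \<Longrightarrow> y \<in> B \<Longrightarrow> x + y \<in> B"
  and subgroup_of_minus: "subgroup_of B \<Longrightarrow> x \<in> B \<Longrightarrow> - x \<in> B"
  by (auto simp: subgroup_of_def)

lemma subgroup_of_diff: "subgroup_of B \<Longrightarrow> x \<in> B \<Longrightarrow> y \<in> B \<Longrightarrow> x - y \<in> B"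
  using subgroup_of_add[of B x "- y"] subgroup_of_minus[of B y] by simp

lemma subgroup_of_sum:
  "subgroup_of B \<Longrightarrow> (\<And>x. x \<in> S \<Longrightarrow> g x \<in> B) \<Longrightarrow> (\<Sum>x\<in>S. g x) \<in> B"
  by (induction S rule: infinite_finite_induct) (auto simp: subgroup_of_zero subgroup_of_add)

lemma coset_eq_iff: "subgroup_of B \<Longrightarrow> coset B x = coset B y \<longleftrightarrow> x - y \<in> B"
proof
  assume B: "subgroup_of B" and "coset B x = coset B y"
  then have "x \<in> coset B y"
    using subgroup_of_zero[OF B] unfolding coset_def by force
  then show "x - y \<in> B" by (auto simp: coset_def)
next
  assume B: "subgroup_of B" and xy: "x - y \<in> B"
  have "x + b = y + ((x - y) + b)" "y + b = x + (b - (x - y))" for b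
    by (simp_all add: algebra_simps)
  then show "coset B x = coset B y"
    unfolding coset_def using subgroup_of_add[OF B] subgroup_of_diff[OF B] xy by blast
qed

lemma coset_zero [simp]: "coset B 0 = B"
  by (auto simp: coset_def)

lemma mem_coset: "z \<in> coset B x \<longleftrightarrow> z - x \<in> B"
  unfolding coset_def by (auto simp: algebra_simps intro: exI[of _ "z - x"])

lemma quot_space_add:
  assumes B: "subgroup_of B"
  shows "coset B x \<oplus>\<^bsub>quot_space sc Z B\<^esub> coset B y = coset B (x + y)"
proof -
  have "{u + w | u w. u \<in> coset B x \<and> w \<in> coset B y} = coset B (x + y)"
  proof (intro Set.set_eqI iffI)
    fix q
    assume "q \<in> {u + w | u w. u \<in> coset B x \<and> w \<in> coset B y}"
    then obtain u w where q: "q = u + w" "u - x \<in> B" "w - y \<in> B"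
      by (auto simp: mem_coset)
    have "(u - x) + (w - y) = q - (x + y)" by (simp add: q(1) add_diff_add)
    then show "q \<in> coset B (x + y)"
      using subgroup_of_add[OF B q(2,3)] by (simp only: mem_coset)
  next
    fix q
    assume "q \<in> coset B (x + y)"
    then have "(q - y) - x \<in> B" by (simp add: mem_coset algebra_simps)
    then have "q - y \<in> coset B x" "y \<in> coset B y" "q = (q - y) + y"
      using subgroup_of_zero[OF B] by (simp_all add: mem_coset)
    then show "q \<in> {u + w | u w. u \<in> coset B x \<and> w \<in> coset B y}" by blast
  qed
  then show ?thesis by (simp add: quot_space_def)
qed

lemma quot_space_smult:
  assumes B: "subgroup_of B"
    and add: "\<And>x y. sc c (x + y) = sc c x + sc c y" and stable: "\<And>x. x \<in> B \<Longrightarrow> sc c x \<in> B"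
  shows "c \<odot>\<^bsub>quot_space sc Z B\<^esub> coset B x = coset B (sc c x)"
proof -
  have "{sc c u + b | u b. u \<in> coset B x \<and> b \<in> B} = coset B (sc c x)"
  proof (intro Set.set_eqI iffI)
    fix q
    assume "q \<in> {sc c u + b | u b. u \<in> coset B x \<and> b \<in> B}"
    then obtain u b where q: "q = sc c u + b" "u - x \<in> B" "b \<in> B"
      by (auto simp: mem_coset)
    have "q - sc c x = sc c (u - x) + b"
      using add[of x "u - x"] by (simp add: q(1))
    then show "q \<in> coset B (sc c x)"
      using subgroup_of_add[OF B stable[OF q(2)] q(3)] by (simp add: mem_coset)
  next
    fix q
    assume "q \<in> coset B (sc c x)"
    then have "q - sc c x \<in> B" "x \<in> coset B x" "q = sc c x + (q - sc c x)"
      using subgroup_of_zero[OF B] by (simp_all add: mem_coset)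
    then show "q \<in> {sc c u + b | u b. u \<in> coset B x \<and> b \<in> B}" by blast
  qed
  then show ?thesis by (simp add: quot_space_def)
qed

lemma quot_space_simps:
  "carrier (quot_space sc Z B) = coset B ` Z"
  "\<zero>\<^bsub>quot_space sc Z B\<^esub> = B"
  by (simp_all add: quot_space_def)

lemma quot_space_abelian_monoid:
  assumes B: "subgroup_of B" and Z: "subgroup_of Z"
  shows "abelian_monoid (quot_space sc Z B)"
proof (rule abelian_monoidI)
  have 0: "B = coset B 0" by simp
  show "\<zero>\<^bsub>quot_space sc Z B\<^esub> \<in> carrier (quot_space sc Z B)"
    using subgroup_of_zero[OF Z] 0 by (force simp: quot_space_simps)
  show "\<zero>\<^bsub>quot_space sc Z B\<^esub> \<oplus>\<^bsub>quot_space sc Z B\<^esub> x = x"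
    if "x \<in> carrier (quot_space sc Z B)" for x
    using that quot_space_add[OF B, where x = 0] by (auto simp: quot_space_simps)
qed (auto simp: quot_space_simps(1) quot_space_add[OF B] subgroup_of_add[OF Z] add_ac)

lemma quot_space_finsum:
  assumes B: "subgroup_of B" and Z: "subgroup_of Z" and "finite S" and "\<And>m. m \<in> S \<Longrightarrow> g m \<in> Z"
  shows "(\<Oplus>\<^bsub>quot_space sc Z B\<^esub>m\<in>S. coset B (g m)) = coset B (\<Sum>m\<in>S. g m)"
proof -
  interpret abelian_monoid "quot_space sc Z B"
    by (rule quot_space_abelian_monoid[OF B Z])
  show ?thesis
    using assms(3,4)
  proof (induction S)
    case empty
    then show ?case by (simp add: quot_space_simps)
  next
    case (insert x S)
    then show ?case
      by (subst finsum_insert) (auto simp: quot_space_add[OF B] quot_space_simps(1))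
  qed
qed


section \<open>The rings of sections of a superelliptic curve\<close>

locale superell_curve =
  fixes C :: "('k::finite_field, 'K::field) superell"
  assumes curve: "is_curve C"
    and expo_ge_2: "2 \<le> expo C"
    and rr_expo: "rr C * expo C = degree (fpol C) + 1"
    and expo_unit: "(of_nat (expo C) :: 'k) \<noteq> 0"
    and fpol_0: "coeff (fpol C) 0 \<noteq> 0"
    and smooth: "\<exists>A B. A * fpol C + B * pderiv (fpol C) = 1"
begin

abbreviation n where "n \<equiv> expo C"
abbreviation r where "r \<equiv> rr C"
abbreviation f where "f \<equiv> fpol C"
abbreviation l where "l \<equiv> degree (fpol C)"
abbreviation t where "t \<equiv> tt C"
abbreviation s where "s \<equiv> ss C"
abbreviation y where "y \<equiv> yy C"
abbreviation z where "z \<equiv> zz C"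

lemma hom_cst: "is_ring_hom (cst C)"
  using curve by (simp add: is_curve_def)

lemmas cst_homs = homs[OF hom_cst]

lemma hom_ev: "is_ring_hom (\<lambda>q. ev C q x)"
  unfolding ev_def by (rule hom_eval[OF hom_cst])

lemma hom_ev2: "is_ring_hom (\<lambda>Q. ev2 C Q a b)"
  unfolding ev2_def by (rule hom_eval[OF hom_ev])

lemmas ev_homs = homs[OF hom_ev] and ev2_homs = homs[OF hom_ev2]

lemma ev_pCons: "ev C (pCons a q) x = cst C a + x * ev C q x"
  by (simp add: ev_def map_poly_pCons cst_homs)

lemma ev_const: "ev C [:a:] x = cst C a"
  by (simp add: ev_pCons ev_homs)

lemma ev_X: "ev C [:0, 1:] x = x"
  by (simp add: ev_pCons ev_homs cst_homs)

lemma ev_monom: "ev C (monom a m) x = cst C a * x ^ m"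
  by (simp add: ev_def map_poly_monom cst_homs poly_monom)

lemma ev2_const: "ev2 C [:q:] a b = ev C q a"
  by (simp add: ev2_def map_poly_pCons ev_homs)

lemma ev2_monom: "ev2 C (monom q m) a b = ev C q a * b ^ m"
  by (simp add: ev2_def map_poly_monom ev_homs poly_monom)

lemma ev_altdef: "degree q \<le> N \<Longrightarrow> ev C q x = (\<Sum>m\<le>N. cst C (coeff q m) * x ^ m)"
  unfolding ev_def
  by (simp add: poly_altdef degree_map_poly hom_nonzero[OF hom_cst] coeff_map_poly cst_homs)
     (auto intro!: sum.mono_neutral_left le_degree simp: cst_homs)

lemma ev2_altdef: "ev2 C Q a b = (\<Sum>m\<le>degree Q. ev C (coeff Q m) a * b ^ m)"
proof -
  have "degree (map_poly (\<lambda>q. ev C q a) Q) \<le> degree Q"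
    by (rule degree_le) (simp add: coeff_map_poly ev_homs coeff_eq_0)
  then show ?thesis
    unfolding ev2_def poly_altdef
    by (intro sum.mono_neutral_cong_left) (auto intro!: le_degree simp: coeff_map_poly ev_homs)
qed

lemma n_pos: "0 < n" and n_Suc: "Suc (n - 1) = n"
  using expo_ge_2 by simp_all

lemma r_pos: "0 < r"
  using rr_expo by (cases "rr C") simp_all

lemma rn_ge_2: "2 \<le> r * n"
  using mult_le_mono[of 1 r 2 n] r_pos expo_ge_2 by simp

lemma l_pos: "0 < l"
  using rr_expo rn_ge_2 by simp

lemma f_nonzero: "f \<noteq> 0"
  using l_pos by auto

lemma n_nonzero: "(of_nat n :: 'K) \<noteq> 0"
  using hom_nonzero[OF hom_cst expo_unit] by (simp add: cst_homs)

lemma relation_dvd: "ev2 C Q t y = 0 \<Longrightarrow> monom 1 n - [:f:] dvd Q"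
  and relation: "ev2 C (monom 1 n - [:f:]) t y = 0"
  using curve by (auto simp: is_curve_def)

lemma y_power: "y ^ n = ev C f t"
  using relation by (simp add: ev2_homs ev2_monom ev2_const ev_homs)

lemma degree_relation: "degree (monom 1 n - [:f:] :: 'k poly poly) = n"
  using n_pos degree_add_eq_left[of "- [:f:]" "monom 1 n"]
  by (simp only: degree_minus diff_conv_add_uminus) (simp add: degree_monom_eq)

text \<open>A nonzero multiple of the monic polynomial \<open>y\<^sup>n - f\<close> has degree at least \<open>n\<close> in \<open>y\<close>.\<close>

lemma ev2_nonzero: "Q \<noteq> 0 \<Longrightarrow> degree Q < n \<Longrightarrow> ev2 C Q t y \<noteq> 0"
  using dvd_imp_degree_le[OF relation_dvd] degree_relation by fastforce

lemma t_nonzero: "t \<noteq> 0"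
  using ev2_nonzero[of "[:[:0, 1:]:]"] n_pos by (simp add: ev2_const ev_X)

lemma y_nonzero: "y \<noteq> 0"
  using ev2_nonzero[of "monom 1 1"] expo_ge_2
  by (simp add: ev2_monom ev_homs degree_monom_eq)

lemma s_nonzero: "s \<noteq> 0"
  using t_nonzero by (simp add: ss_def)

lemma z_nonzero: "z \<noteq> 0"
  using s_nonzero y_nonzero by (simp add: zz_def)

lemma st: "s * t = 1" and ts: "t * s = 1"
  using t_nonzero by (simp_all add: ss_def)

lemma st_power: "s ^ m * t ^ m = 1" and ts_power: "t ^ m * s ^ m = 1"
  using st ts by (simp_all flip: power_mult_distrib)

lemma t_s_power_ge: "m \<le> e \<Longrightarrow> t ^ e * s ^ m = t ^ (e - m)"
  using power_add[of t "e - m" m] ts_power[of m] by (simp add: mult.assoc)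

lemma t_s_power_le: "e \<le> m \<Longrightarrow> t ^ e * s ^ m = s ^ (m - e)"
  using power_add[of s e "m - e"] ts_power[of e] by (simp add: mult.assoc[symmetric])

lemma y_conv: "y = t ^ r * z"
  using ts_power[of r] by (simp add: zz_def mult.assoc[symmetric])

lemma z_power: "z ^ n = s ^ (r * n) * ev C f t"
  by (simp add: zz_def power_mult_distrib y_power power_mult)

lemma z_power_at_infty: "z ^ n = ev C (at_infty l f) s"
proof -
  have "s ^ (l + 1) * t ^ m = s ^ (l + 1 - m)" if "m \<le> l" for m
    using t_s_power_le[of m "l + 1"] that by (simp add: mult.commute)
  then show ?thesis
    unfolding z_power rr_expo at_infty_def ev_altdef[of f l, OF order.refl]
    by (simp add: ev_homs ev_monom sum_distrib_left mult.left_commute del: power_Suc)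
qed

text \<open>
  The polynomial \<open>f\<^sub>2\<close> vanishes to order exactly one at \<open>s = 0\<close>: the point at infinity is a
  branch point, and \<open>z\<close> is a parameter there.
\<close>

lemma coeff_pderiv_at_infty: "coeff (pderiv (at_infty l f)) 0 \<noteq> 0"
proof -
  have "coeff (at_infty l f) 1 = (\<Sum>m\<le>l. if m = l then coeff f l else 0)"
    unfolding at_infty_def coeff_sum by (intro sum.cong) auto
  then show ?thesis
    using f_nonzero by (simp add: coeff_pderiv)
qed

definition subalgebra :: "'K set \<Rightarrow> bool" where
  "subalgebra A \<longleftrightarrow> range (cst C) \<subseteq> A \<and> (\<forall>a\<in>A. \<forall>b\<in>A. a + b \<in> A \<and> a * b \<in> A)"

lemma subalgebra_cst: "subalgebra A \<Longrightarrow> cst C a \<in> A"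
  and subalgebra_add: "subalgebra A \<Longrightarrow> u \<in> A \<Longrightarrow> w \<in> A \<Longrightarrow> u + w \<in> A"
  and subalgebra_mult: "subalgebra A \<Longrightarrow> u \<in> A \<Longrightarrow> w \<in> A \<Longrightarrow> u * w \<in> A"
  by (auto simp: subalgebra_def)

lemma subalgebra_zero: "subalgebra A \<Longrightarrow> 0 \<in> A"
  and subalgebra_one: "subalgebra A \<Longrightarrow> 1 \<in> A"
  and subalgebra_of_nat: "subalgebra A \<Longrightarrow> of_nat m \<in> A"
  using subalgebra_cst[of A 0] subalgebra_cst[of A 1] subalgebra_cst[of A "of_nat m"]
  by (simp_all add: cst_homs)

lemma subalgebra_minus: "subalgebra A \<Longrightarrow> u \<in> A \<Longrightarrow> - u \<in> A"
  using subalgebra_mult[of A "cst C (- 1)" u] subalgebra_cst[of A "- 1"]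
  by (simp add: cst_homs)

lemma subalgebra_subgroup: "subalgebra A \<Longrightarrow> subgroup_of A"
  by (simp add: subgroup_of_def subalgebra_zero subalgebra_add subalgebra_minus)

lemma subalgebra_power: "subalgebra A \<Longrightarrow> u \<in> A \<Longrightarrow> u ^ m \<in> A"
  by (induction m) (simp_all add: subalgebra_one subalgebra_mult)

lemmas subalgebra_sum = subgroup_of_sum[OF subalgebra_subgroup]

lemmas subalgebra_intros = subalgebra_cst subalgebra_add subalgebra_mult subalgebra_zero
  subalgebra_one subalgebra_of_nat subalgebra_minus subalgebra_power subalgebra_sum

lemma subalgebra_ev: "subalgebra A \<Longrightarrow> a \<in> A \<Longrightarrow> ev C q a \<in> A"
  by (simp add: ev_altdef[OF order.refl] subalgebra_intros)

lemma subalgebra_ev2: "subalgebra A \<Longrightarrow> a \<in> A \<Longrightarrow> b \<in> A \<Longrightarrow> ev2 C Q a b \<in> A"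
  by (simp add: ev2_altdef subalgebra_intros subalgebra_ev)

lemma subalgebra_range_ev2: "subalgebra {ev2 C Q a b | Q. True}"
  unfolding subalgebra_def
proof (intro conjI ballI)
  show "range (cst C) \<subseteq> {ev2 C Q a b | Q. True}"
  proof
    fix x
    assume "x \<in> range (cst C)"
    then obtain a' where "x = cst C a'" by blast
    then have "x = ev2 C [:[:a':]:] a b" by (simp add: ev2_const ev_const)
    then show "x \<in> {ev2 C Q a b | Q. True}" by blast
  qed
next
  fix u w
  assume "u \<in> {ev2 C Q a b | Q. True}" "w \<in> {ev2 C Q a b | Q. True}"
  then obtain Q R where "u = ev2 C Q a b" "w = ev2 C R a b" by blast
  then have "u + w = ev2 C (Q + R) a b" "u * w = ev2 C (Q * R) a b"
    by (simp_all add: ev2_homs)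
  then show "u + w \<in> {ev2 C Q a b | Q. True}" "u * w \<in> {ev2 C Q a b | Q. True}"
    by blast+
qed

lemma subalgebra_fractions:
  assumes A: "subalgebra A" and "u \<in> A" "u \<noteq> 0"
  shows "subalgebra {g / u ^ N | g N. g \<in> A}"
  unfolding subalgebra_def
proof (intro conjI ballI)
  show "range (cst C) \<subseteq> {g / u ^ N | g N. g \<in> A}"
  proof
    fix x
    assume "x \<in> range (cst C)"
    then have "x \<in> A" "x = x / u ^ 0" using subalgebra_cst[OF A] by auto
    then show "x \<in> {g / u ^ N | g N. g \<in> A}" by blast
  qed
next
  fix a b
  assume "a \<in> {g / u ^ N | g N. g \<in> A}" "b \<in> {g / u ^ N | g N. g \<in> A}"
  then obtain g N g' N' where a: "a = g / u ^ N" "g \<in> A" and b: "b = g' / u ^ N'" "g' \<in> A"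
    by blast
  have "a + b = (g * u ^ N' + g' * u ^ N) / u ^ (N + N')"
    using assms(3) by (simp add: a b power_add divide_simps)
  moreover have "g * u ^ N' + g' * u ^ N \<in> A"
    by (intro subalgebra_intros[OF A] a b assms)
  ultimately show "a + b \<in> {g / u ^ N | g N. g \<in> A}" by blast
  have "a * b = (g * g') / u ^ (N + N')"
    by (simp add: a b power_add)
  moreover have "g * g' \<in> A" by (intro subalgebra_mult[OF A] a b)
  ultimately show "a * b \<in> {g / u ^ N | g N. g \<in> A}" by blast
qed

lemma fst_mem: "t \<in> {ev2 C Q t b | Q. True}" and snd_mem: "b \<in> {ev2 C Q a b | Q. True}"
proof -
  have "t = ev2 C [:[:0, 1:]:] t b" "b = ev2 C (monom 1 1) a b"
    by (simp_all add: ev2_const ev_X ev2_monom ev_homs)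
  then show "t \<in> {ev2 C Q t b | Q. True}" "b \<in> {ev2 C Q a b | Q. True}" by blast+
qed

lemma O_Ubar_alt: "O_Ubar C = {g / y ^ N | g N. g \<in> {ev2 C Q t y | Q. True}}"
  unfolding O_Ubar_def by blast

lemma O_UV_alt: "O_UV C = {g / (t * y) ^ N | g N. g \<in> {ev2 C Q t y | Q. True}}"
  unfolding O_UV_def by blast

lemma subalgebra_Ubar: "subalgebra (O_Ubar C)"
  unfolding O_Ubar_alt
  by (rule subalgebra_fractions[OF subalgebra_range_ev2 snd_mem y_nonzero])

lemma subalgebra_UV: "subalgebra (O_UV C)"
  unfolding O_UV_alt
  by (rule subalgebra_fractions[OF subalgebra_range_ev2
        subalgebra_mult[OF subalgebra_range_ev2 fst_mem snd_mem]])
     (simp add: t_nonzero y_nonzero)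

lemma subalgebra_V: "subalgebra (O_V C)"
  unfolding O_V_def by (rule subalgebra_range_ev2)

lemmas Ubar_intros = subalgebra_intros[OF subalgebra_Ubar] subalgebra_ev[OF subalgebra_Ubar]
lemmas UV_intros = subalgebra_intros[OF subalgebra_UV] subalgebra_ev[OF subalgebra_UV]
lemmas V_intros = subalgebra_intros[OF subalgebra_V] subalgebra_ev[OF subalgebra_V]

lemma ev2_Ubar: "ev2 C Q t y \<in> O_Ubar C"
proof -
  have "ev2 C Q t y = ev2 C Q t y / y ^ 0" by simp
  then show ?thesis unfolding O_Ubar_def by blast
qed

lemma t_Ubar: "t \<in> O_Ubar C"
  using ev2_Ubar[of "[:[:0, 1:]:]"] by (simp add: ev2_const ev_X)

lemma y_Ubar: "y \<in> O_Ubar C"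
  using ev2_Ubar[of "monom 1 1"] by (simp add: ev2_monom ev_homs)

lemma inverse_y_Ubar: "inverse y \<in> O_Ubar C"
proof -
  have "inverse y = ev2 C 1 t y / y ^ 1" by (simp add: ev2_homs divide_inverse)
  then show ?thesis unfolding O_Ubar_def by blast
qed

lemma s_V: "s \<in> O_V C"
proof -
  have "s = ev2 C [:[:0, 1:]:] s z" by (simp add: ev2_const ev_X)
  then show ?thesis unfolding O_V_def by blast
qed

lemma z_V: "z \<in> O_V C"
  unfolding O_V_def by (rule snd_mem)

lemma s_UV: "s \<in> O_UV C"
proof -
  have "s = ev2 C (monom 1 1) t y / (t * y) ^ 1"
    using t_nonzero y_nonzero by (simp add: ev2_monom ev_homs ss_def divide_inverse)
  then show ?thesis unfolding O_UV_def by blast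
qed

lemma Ubar_UV: "g \<in> O_Ubar C \<Longrightarrow> g \<in> O_UV C"
proof -
  assume "g \<in> O_Ubar C"
  then obtain Q N where "g = ev2 C Q t y / y ^ N" unfolding O_Ubar_def by blast
  also have "\<dots> = (ev2 C Q t y * t ^ N) / (t * y) ^ N"
    using t_nonzero by (simp add: power_mult_distrib)
  finally have "g = (ev2 C Q t y * t ^ N) / (t * y) ^ N" .
  moreover have "ev2 C Q t y * t ^ N \<in> {ev2 C Q t y | Q. True}"
    by (intro subalgebra_intros[OF subalgebra_range_ev2] fst_mem) blast
  ultimately show "g \<in> O_UV C" unfolding O_UV_alt by blast
qed

lemmas t_UV = Ubar_UV[OF t_Ubar] and y_UV = Ubar_UV[OF y_Ubar]
  and inverse_y_UV = Ubar_UV[OF inverse_y_Ubar]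


text \<open>
  Partial fractions in \<open>t\<close> separate the poles at \<open>t = 0\<close> from those at \<open>y = 0\<close>, because
  \<open>f(0) \<noteq> 0\<close>. What remains are monomials \<open>t\<^sup>e y\<^sup>j\<close>; they are regular on \<open>\<U>\<close> for \<open>e \<ge> 0\<close> and
  on \<open>\<V>\<close> for \<open>- e \<ge> r j\<close>, and otherwise are basis elements of the first cohomology.
\<close>

theorem O_UV_induct [consumes 1, case_names Ubar V basis add scale]:
  assumes g: "g \<in> O_UV C"
    and Ubar: "\<And>g. g \<in> O_Ubar C \<Longrightarrow> P g"
    and V: "\<And>g. g \<in> O_V C \<Longrightarrow> P g"
    and basis: "\<And>i j. 1 \<le> j \<Longrightarrow> j \<le> n - 1 \<Longrightarrow> 1 \<le> i \<Longrightarrow> i \<le> r * j - 1 \<Longrightarrow> P (bas_h C i j)"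
    and add: "\<And>g h. g \<in> O_UV C \<Longrightarrow> h \<in> O_UV C \<Longrightarrow> P g \<Longrightarrow> P h \<Longrightarrow> P (g + h)"
    and scale: "\<And>a g. g \<in> O_UV C \<Longrightarrow> P g \<Longrightarrow> P (cst C a * g)"
  shows "P g"
proof -
  have zero: "P 0" by (rule Ubar) (simp add: Ubar_intros)
  have sum: "P (\<Sum>x\<in>S. g x)" if "\<And>x. x \<in> S \<Longrightarrow> g x \<in> O_UV C \<and> P (g x)"
    for S and g :: "nat \<Rightarrow> 'K"
    using that by (induction S rule: infinite_finite_induct)
      (auto simp: zero UV_intros intro!: add)
  have monomial: "P (y ^ j * t ^ e * s ^ N)" if j: "j < n" for j e N
  proof (cases "N \<le> e")
    case True
    then show ?thesis
      by (intro Ubar) (simp add: mult.assoc t_s_power_ge Ubar_intros t_Ubar y_Ubar)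
  next
    case False
    define m where "m = N - e"
    have eq: "y ^ j * t ^ e * s ^ N = y ^ j * s ^ m"
      using False by (simp add: mult.assoc t_s_power_le m_def)
    show ?thesis
    proof (cases "r * j \<le> m")
      case True
      have "y ^ j * s ^ m = z ^ j * (t ^ (r * j) * s ^ m)"
        by (simp add: y_conv power_mult_distrib power_mult)
      then show ?thesis
        using True by (intro V) (simp add: eq t_s_power_le V_intros s_V z_V)
    next
      case False
      moreover have "0 < m" using \<open>\<not> N \<le> e\<close> by (simp add: m_def)
      moreover have "j \<noteq> 0" using False by (cases j) auto
      ultimately have "P (bas_h C m j)"
        using j by (intro basis) linarith+
      moreover have "bas_h C m j = y ^ j * s ^ m"
        by (simp add: bas_h_def ss_def divide_inverse power_inverse)
      ultimately show ?thesis by (simp only: eq)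
    qed
  qed
  have t_poly: "P (ev C q t * y ^ j * t ^ e * s ^ N)" if "j < n" for q j e N
  proof -
    have "ev C q t * y ^ j * t ^ e * s ^ N =
        (\<Sum>m\<le>degree q. cst C (coeff q m) * (y ^ j * t ^ (m + e) * s ^ N))"
      unfolding ev_altdef[OF order.refl] sum_distrib_right
      by (intro sum.cong) (simp_all add: power_add mult_ac)
    then show ?thesis
      by (simp only:) (intro sum conjI scale monomial that UV_intros t_UV y_UV s_UV)
  qed
  have poly: "P (ev2 C Q t y * s ^ N)" for Q N
  proof -
    obtain M where "ev2 C Q t y = (\<Sum>m\<le>M. ev C (coeff Q m) t * y ^ m)"
      using ev2_altdef by blast
    moreover have "P (ev C q t * y ^ m * s ^ N)" for q m
    proof -
      have "y ^ m = y ^ (n * (m div n) + m mod n)" by simp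
      also have "\<dots> = ev C f t ^ (m div n) * y ^ (m mod n)"
        by (simp only: power_add power_mult y_power)
      finally have "ev C q t * y ^ m * s ^ N =
          ev C (q * f ^ (m div n)) t * y ^ (m mod n) * t ^ 0 * s ^ N"
        by (simp add: ev_homs mult_ac)
      then show ?thesis
        by (simp only: t_poly mod_less_divisor[OF n_pos])
    qed
    ultimately show ?thesis
      by (simp only: sum_distrib_right) (intro sum conjI UV_intros t_UV y_UV s_UV)
  qed
  obtain Q N where "g = ev2 C Q t y / (t * y) ^ N"
    using g unfolding O_UV_def by blast
  then have g_eq: "g = ev2 C Q t y * s ^ N * inverse y ^ N"
    by (simp add: divide_inverse ss_def power_mult_distrib power_inverse mult_ac)
  obtain A B where "f ^ N * A + [:0, 1:] ^ N * B = 1"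
    using bezout_X[OF fpol_0] bezout_powers by blast
  then have "ev C (f ^ N * A + [:0, 1:] ^ N * B) t = 1" by (simp add: ev_homs)
  then have one: "y ^ (n * N) * ev C A t + t ^ N * ev C B t = 1"
    by (simp only: ev_homs ev_X power_mult y_power)
  have "y ^ (n * N) * inverse y ^ N = y ^ ((n - 1) * N)"
  proof -
    have "n * N = (n - 1) * N + N" using n_Suc by (metis add.commute mult_Suc)
    then show ?thesis using y_nonzero by (simp add: power_add power_inverse)
  qed
  note cancel = this
  \<comment> \<open>The first summand of \<open>1\<close> cancels the pole along \<open>y = 0\<close>, the second the one along \<open>t = 0\<close>.\<close>
  have "g = g * (y ^ (n * N) * ev C A t + t ^ N * ev C B t)"
    by (simp only: one mult_1_right)
  also have "\<dots> = ev2 C Q t y * (y ^ (n * N) * inverse y ^ N) * ev C A t * s ^ N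
      + ev2 C Q t y * inverse y ^ N * ev C B t * (t ^ N * s ^ N)"
    unfolding g_eq by (simp only: distrib_left mult_ac)
  finally have g_split: "g = ev2 C Q t y * y ^ ((n - 1) * N) * ev C A t * s ^ N
      + ev2 C Q t y * inverse y ^ N * ev C B t"
    by (simp only: cancel ts_power mult_1_right)
  have "ev2 C Q t y * y ^ ((n - 1) * N) * ev C A t
      = ev2 C (Q * monom 1 ((n - 1) * N) * [:A:]) t y"
    by (simp only: ev2_homs ev2_monom ev2_const ev_homs mult_1_left)
  then have 1: "P (ev2 C Q t y * y ^ ((n - 1) * N) * ev C A t * s ^ N)"
    using poly by metis
  have 2: "ev2 C Q t y * y ^ ((n - 1) * N) * ev C A t * s ^ N \<in> O_UV C"
    by (intro UV_intros t_UV y_UV s_UV Ubar_UV[OF ev2_Ubar])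
  have 3: "ev2 C Q t y * inverse y ^ N * ev C B t \<in> O_Ubar C"
    by (intro Ubar_intros ev2_Ubar inverse_y_Ubar t_Ubar)
  show ?thesis
    unfolding g_split by (rule add[OF 2 Ubar_UV[OF 3] 1 Ubar[OF 3]])
qed

end


section \<open>Regular differentials on the two charts\<close>

lemma forms_zero: "0 \<in> forms A"
  unfolding forms_def by (auto intro!: exI[of _ "[]"])

lemma forms_single: "a \<in> A \<Longrightarrow> b \<in> A \<Longrightarrow> a *\<^sub>\<Omega> dif b \<in> forms A"
  unfolding forms_def by (auto intro!: exI[of _ "[(a, b)]"])

lemma forms_add: "\<omega> \<in> forms A \<Longrightarrow> \<eta> \<in> forms A \<Longrightarrow> \<omega> + \<eta> \<in> forms A"
proof -
  assume "\<omega> \<in> forms A" "\<eta> \<in> forms A"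
  then obtain xs ys where "\<omega> = (\<Sum>(a, b)\<leftarrow>xs. a *\<^sub>\<Omega> dif b)" "set xs \<subseteq> A \<times> A"
    "\<eta> = (\<Sum>(a, b)\<leftarrow>ys. a *\<^sub>\<Omega> dif b)" "set ys \<subseteq> A \<times> A"
    unfolding forms_def by blast
  then show "\<omega> + \<eta> \<in> forms A"
    unfolding forms_def by (auto intro!: exI[of _ "xs @ ys"])
qed

lemma scale_form_cancel:
  fixes u :: "'a::field"
  assumes "u \<noteq> 0" "u *\<^sub>\<Omega> \<omega> = u *\<^sub>\<Omega> \<eta>"
  shows "\<omega> = \<eta>"
  using arg_cong[OF assms(2), of "\<lambda>x. inverse u *\<^sub>\<Omega> x"] assms(1) by (simp add: scale_form_scale)

context superell_curve
begin

lemma forms_scale: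
  assumes A: "subalgebra A" and c: "c \<in> A" and "\<omega> \<in> forms A"
  shows "c *\<^sub>\<Omega> \<omega> \<in> forms A"
proof -
  obtain xs where xs: "\<omega> = (\<Sum>(a, b)\<leftarrow>xs. a *\<^sub>\<Omega> dif b)" "set xs \<subseteq> A \<times> A"
    using assms(3) unfolding forms_def by blast
  have "c *\<^sub>\<Omega> (\<Sum>(a, b)\<leftarrow>xs. a *\<^sub>\<Omega> dif b) \<in> forms A"
    using xs(2)
  proof (induction xs)
    case Nil
    then show ?case by (simp add: forms_zero)
  next
    case (Cons x xs)
    obtain a b where x: "x = (a, b)" by (cases x)
    have "(c * a) *\<^sub>\<Omega> dif b \<in> forms A"
      using Cons.prems by (intro forms_single subalgebra_mult[OF A] c) (simp_all add: x)
    then show ?case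
      using Cons by (simp add: x scale_form_add_right scale_form_scale forms_add)
  qed
  then show ?thesis by (simp add: xs(1))
qed

lemma forms_subgroup:
  assumes A: "subalgebra A"
  shows "subgroup_of (forms A)"
proof (rule subgroup_ofI)
  fix \<omega> assume "\<omega> \<in> forms A"
  then show "- \<omega> \<in> forms A"
    using forms_scale[OF A subalgebra_minus[OF A subalgebra_one[OF A]]]
    by (metis scale_form_minus_left scale_form_one)
qed (simp_all add: forms_zero forms_add)

lemma forms_dif: "subalgebra A \<Longrightarrow> b \<in> A \<Longrightarrow> dif b \<in> forms A"
  using forms_single[of 1 A b] by (simp add: subalgebra_one)

lemmas forms_intros = forms_scale forms_add subgroup_of_diff[OF forms_subgroup]
  subgroup_of_minus[OF forms_subgroup] forms_dif

lemma dif_cst: "dif (cst C a) = 0"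
  by (rule dif_const[OF hom_cst])

lemma dif_ev: "dif (ev C q x) = ev C (pderiv q) x *\<^sub>\<Omega> dif x"
proof (induction q)
  case 0
  then show ?case by (simp add: ev_homs)
next
  case (pCons a q)
  then show ?case
    by (simp add: ev_pCons pderiv_pCons ev_homs cst_homs dif_add dif_mult dif_cst
        scale_form_scale scale_form_add_left add_ac)
qed

lemma dif_s: "dif s = (- (s ^ 2)) *\<^sub>\<Omega> dif t"
  unfolding ss_def by (rule dif_inverse[OF t_nonzero])

lemma dif_t: "dif t = (- (t ^ 2)) *\<^sub>\<Omega> dif s"
  using dif_inverse[OF s_nonzero] by (simp add: ss_def)

lemma dif_y_power: "(of_nat n * y ^ (n - 1)) *\<^sub>\<Omega> dif y = ev C (pderiv f) t *\<^sub>\<Omega> dif t"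
  by (simp only: y_power flip: dif_power dif_ev)

lemma dif_y: "dif y = (ev C (pderiv f) t / (of_nat n * y ^ (n - 1))) *\<^sub>\<Omega> dif t"
proof (rule scale_form_cancel)
  show "of_nat n * y ^ (n - 1) \<noteq> 0"
    using n_nonzero y_nonzero by simp
  then show "(of_nat n * y ^ (n - 1)) *\<^sub>\<Omega> dif y = (of_nat n * y ^ (n - 1)) *\<^sub>\<Omega>
      (ev C (pderiv f) t / (of_nat n * y ^ (n - 1))) *\<^sub>\<Omega> dif t"
    unfolding dif_y_power scale_form_scale by simp
qed

text \<open>
  At the point \<open>s = z = 0\<close>, where \<open>z\<close> is a parameter and \<open>ds\<close> vanishes to order \<open>n - 1\<close>, this form
  has neither zero nor pole.
\<close>

definition omega_inf :: "'K kaehler" where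
  "omega_inf = inverse (z ^ (n - 1)) *\<^sub>\<Omega> dif s"

lemma z_omega_inf: "z ^ (n - 1) *\<^sub>\<Omega> omega_inf = dif s"
  using z_nonzero by (simp add: omega_inf_def scale_form_scale)

text \<open>
  Writing \<open>1 = A f + B f'\<close> on the affine part shows that \<open>s\<^sup>M\<close> times the form is regular on \<open>\<V>\<close>
  for large \<open>M\<close>. Near \<open>s = 0\<close> the identity \<open>f\<^sub>2'(s) ds = n z\<^bsup>n-1\<^esup> dz\<close> makes \<open>f\<^sub>2'(s)\<close> times the
  form regular. Since \<open>f\<^sub>2'(0) \<noteq> 0\<close>, the polynomials \<open>s\<^sup>M\<close> and \<open>f\<^sub>2'(s)\<close> generate the unit ideal.
\<close>

lemma omega_inf_V: "omega_inf \<in> forms (O_V C)"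
proof -
  note [simp] = power_inverse
  have y: "y ^ (n - 1) = t ^ (r * (n - 1)) * z ^ (n - 1)"
    by (simp add: y_conv power_mult_distrib power_mult)
  have rn: "r * n = r * (n - 1) + r"
    using n_Suc by (metis add.commute mult_Suc_right)

  \<comment> \<open>Since \<open>f'(t) dt = n y\<^bsup>n-1\<^esup> dy\<close>, the form \<open>s\<^bsup>rn\<^esup> f'(t) z\<^bsup>-(n-1)\<^esup> ds\<close> is \<open>- n s\<^sup>2 s\<^sup>r dy\<close>,
    and \<open>s\<^sup>r dy\<close> becomes regular when expressed by \<open>dz\<close> and \<open>ds\<close>.\<close>
  have "s ^ r *\<^sub>\<Omega> dif y = dif z - (of_nat r * s ^ (r - 1) * y) *\<^sub>\<Omega> dif s"
    unfolding zz_def by (simp add: dif_mult dif_power scale_form_scale mult_ac)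
  then have "(- (of_nat n * s ^ 2)) *\<^sub>\<Omega> s ^ r *\<^sub>\<Omega> dif y =
      (- (of_nat n * s ^ 2)) *\<^sub>\<Omega> dif z -
      (- (of_nat n * s ^ 2)) *\<^sub>\<Omega> (of_nat r * s ^ (r - 1) * y) *\<^sub>\<Omega> dif s"
    by (metis (no_types, opaque_lifting) add_uminus_conv_diff scale_form_add_right
        scale_form_minus_right)
  also have "(- (of_nat n * s ^ 2)) *\<^sub>\<Omega> (of_nat r * s ^ (r - 1) * y) *\<^sub>\<Omega> dif s =
      (- (of_nat n * of_nat r * s * z)) *\<^sub>\<Omega> dif s"
  proof -
    have "s ^ 2 * s ^ (r - 1) = s * s ^ r"
      using r_pos by (cases r) (simp_all add: power2_eq_square)
    then have "(of_nat n * s ^ 2) * (of_nat r * s ^ (r - 1) * y) = of_nat n * of_nat r * s * z"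
      unfolding zz_def by (simp add: mult_ac)
    then show ?thesis by (simp only: scale_form_scale mult_minus_left)
  qed
  finally have dy: "(- (of_nat n * s ^ 2)) *\<^sub>\<Omega> s ^ r *\<^sub>\<Omega> dif y \<in> forms (O_V C)"
    by (simp only:) (intro forms_intros subalgebra_V V_intros s_V z_V)
  have f': "(s ^ (r * n) * ev C (pderiv f) t) *\<^sub>\<Omega> omega_inf \<in> forms (O_V C)"
  proof -
    have "ev C (pderiv f) t *\<^sub>\<Omega> dif s = (- (s ^ 2)) *\<^sub>\<Omega> ev C (pderiv f) t *\<^sub>\<Omega> dif t"
      by (simp add: dif_s scale_form_scale mult_ac)
    also have "\<dots> = (- (of_nat n * s ^ 2) * y ^ (n - 1)) *\<^sub>\<Omega> dif y"
      by (simp add: scale_form_scale mult_ac flip: dif_y_power)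
    finally have ds: "ev C (pderiv f) t *\<^sub>\<Omega> dif s = \<dots>" .
    have "(s ^ (r * n) * ev C (pderiv f) t) *\<^sub>\<Omega> omega_inf =
        (s ^ (r * n) * inverse (z ^ (n - 1))) *\<^sub>\<Omega> ev C (pderiv f) t *\<^sub>\<Omega> dif s"
      by (simp add: omega_inf_def scale_form_scale mult_ac)
    also have "\<dots> = (s ^ (r * n) * inverse (z ^ (n - 1)) * y ^ (n - 1)) *\<^sub>\<Omega>
        (- (of_nat n * s ^ 2)) *\<^sub>\<Omega> dif y"
      unfolding ds by (simp add: scale_form_scale mult_ac)
    also have "s ^ (r * n) * inverse (z ^ (n - 1)) * y ^ (n - 1) =
        s ^ r * (s ^ (r * (n - 1)) * t ^ (r * (n - 1))) * (inverse (z ^ (n - 1)) * z ^ (n - 1))"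
      unfolding y rn by (simp add: power_add mult_ac)
    also have "\<dots> = s ^ r"
      using z_nonzero by (simp only: st_power) simp
    finally show ?thesis
      using dy by (simp add: scale_form_scale mult_ac)
  qed
  have f: "(s ^ (r * n) * ev C f t) *\<^sub>\<Omega> omega_inf \<in> forms (O_V C)"
  proof -
    have "(s ^ (r * n) * ev C f t) *\<^sub>\<Omega> omega_inf = z *\<^sub>\<Omega> dif s"
      using n_Suc power_Suc[of z "n - 1"]
      by (simp add: scale_form_scale flip: z_omega_inf z_power)
    then show ?thesis by (simp add: forms_single s_V z_V)
  qed
  obtain A B where AB: "A * f + B * pderiv f = 1" using smooth by blast
  define N where "N = max (degree A) (degree B)"
  have pole: "s ^ N * ev C q t \<in> O_V C" if "degree q \<le> N" for q
  proof -
    have "s ^ N * ev C q t = (\<Sum>m\<le>N. cst C (coeff q m) * (t ^ m * s ^ N))"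
      using that by (simp add: ev_altdef sum_distrib_left mult_ac)
    also have "\<dots> = (\<Sum>m\<le>N. cst C (coeff q m) * s ^ (N - m))"
      by (intro sum.cong) (simp_all add: t_s_power_le)
    also have "\<dots> \<in> O_V C" by (intro V_intros s_V)
    finally show ?thesis .
  qed
  have "s ^ (N + r * n) = s ^ (N + r * n) * ev C (A * f + B * pderiv f) t"
    by (simp add: AB ev_homs)
  also have "\<dots> = (s ^ N * ev C A t) * (s ^ (r * n) * ev C f t)
      + (s ^ N * ev C B t) * (s ^ (r * n) * ev C (pderiv f) t)"
    by (simp add: ev_homs power_add algebra_simps)
  finally have "s ^ (N + r * n) *\<^sub>\<Omega> omega_inf =
      (s ^ N * ev C A t) *\<^sub>\<Omega> (s ^ (r * n) * ev C f t) *\<^sub>\<Omega> omega_inf +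
      (s ^ N * ev C B t) *\<^sub>\<Omega> (s ^ (r * n) * ev C (pderiv f) t) *\<^sub>\<Omega> omega_inf"
    by (simp only: scale_form_scale scale_form_add_left)
  then have sM: "s ^ (N + r * n) *\<^sub>\<Omega> omega_inf \<in> forms (O_V C)"
    by (simp only:) (intro forms_intros subalgebra_V f f' pole, simp_all add: N_def)

  define g where "g = pderiv (at_infty l f)"
  have "(of_nat n * z ^ (n - 1)) *\<^sub>\<Omega> dif z = ev C g s *\<^sub>\<Omega> dif s"
    unfolding g_def by (simp only: z_power_at_infty flip: dif_power dif_ev)
  also have "\<dots> = z ^ (n - 1) *\<^sub>\<Omega> ev C g s *\<^sub>\<Omega> omega_inf"
    by (simp add: scale_form_scale mult_ac flip: z_omega_inf)
  finally have "z ^ (n - 1) *\<^sub>\<Omega> of_nat n *\<^sub>\<Omega> dif z = z ^ (n - 1) *\<^sub>\<Omega> ev C g s *\<^sub>\<Omega> omega_inf"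
    by (simp add: scale_form_scale mult_ac)
  then have "of_nat n *\<^sub>\<Omega> dif z = ev C g s *\<^sub>\<Omega> omega_inf"
    by (rule scale_form_cancel[rotated]) (simp add: z_nonzero)
  moreover have "of_nat n *\<^sub>\<Omega> dif z \<in> forms (O_V C)"
    by (intro forms_intros subalgebra_V V_intros z_V)
  ultimately have g: "ev C g s *\<^sub>\<Omega> omega_inf \<in> forms (O_V C)" by simp
  obtain A' B' where "g ^ 1 * A' + [:0, 1:] ^ (N + r * n) * B' = 1"
    using bezout_X[OF coeff_pderiv_at_infty] bezout_powers unfolding g_def by blast
  then have "ev C (g ^ 1 * A' + [:0, 1:] ^ (N + r * n) * B') s = 1"
    by (simp only: ev_homs)
  then have "ev C A' s * ev C g s + ev C B' s * s ^ (N + r * n) = 1"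
    by (simp only: ev_homs ev_X power_one_right mult_ac)
  then have "omega_inf =
      ev C A' s *\<^sub>\<Omega> ev C g s *\<^sub>\<Omega> omega_inf + ev C B' s *\<^sub>\<Omega> s ^ (N + r * n) *\<^sub>\<Omega> omega_inf"
    by (metis scale_form_add_left scale_form_one scale_form_scale)
  also have "\<dots> \<in> forms (O_V C)"
    by (intro forms_intros subalgebra_V V_intros g sM s_V)
  finally show ?thesis .
qed

lemma bas_om_Ubar: "bas_om C i j \<in> forms (O_Ubar C)"
proof -
  have "bas_om C i j = (t ^ i * inverse y ^ j) *\<^sub>\<Omega> dif t"
    by (simp add: bas_om_def divide_inverse power_inverse)
  then show ?thesis
    by (simp only:) (intro forms_intros subalgebra_Ubar Ubar_intros t_Ubar inverse_y_Ubar)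
qed

lemma bas_om_UV: "bas_om C i j \<in> forms (O_UV C)"
proof -
  have "bas_om C i j = (t ^ i * inverse y ^ j) *\<^sub>\<Omega> dif t"
    by (simp add: bas_om_def divide_inverse power_inverse)
  then show ?thesis
    by (simp only:) (intro forms_intros subalgebra_UV UV_intros t_UV inverse_y_UV)
qed

lemma z_bas_om_coeff:
  assumes "i + 2 \<le> r * j"
  shows "z ^ j * (t ^ i / y ^ j * t ^ 2) = s ^ (r * j - 2 - i)"
proof -
  have e: "r * j - 2 - i = r * j - (i + 2)" by simp
  have "z ^ j * (t ^ i / y ^ j * t ^ 2) = t ^ (i + 2) * s ^ (r * j)"
    using y_nonzero by (simp add: zz_def power_mult_distrib power_mult power_add power2_eq_square)
  also have "\<dots> = s ^ (r * j - 2 - i)"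
    using assms unfolding e by (rule t_s_power_le)
  finally show ?thesis .
qed

lemma z_bas_om:
  assumes "i + 2 \<le> r * j"
  shows "z ^ j *\<^sub>\<Omega> bas_om C i j = (- (s ^ (r * j - 2 - i))) *\<^sub>\<Omega> dif s"
  using z_bas_om_coeff[OF assms]
  by (simp only: bas_om_def dif_t scale_form_scale mult_minus_right mult.assoc)

lemma bas_om_V:
  assumes "i + 2 \<le> r * j" "j \<le> n - 1"
  shows "bas_om C i j \<in> forms (O_V C)"
proof -
  have "z ^ j *\<^sub>\<Omega> bas_om C i j =
      z ^ j *\<^sub>\<Omega> (- (s ^ (r * j - 2 - i) * z ^ (n - 1 - j))) *\<^sub>\<Omega> omega_inf"
    using assms(2) power_add[of z j "n - 1 - j"]
    unfolding z_bas_om[OF assms(1)] z_omega_inf[symmetric] scale_form_scale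
    by (simp add: mult_ac del: diff_diff_left)
  then have "bas_om C i j = (- (s ^ (r * j - 2 - i) * z ^ (n - 1 - j))) *\<^sub>\<Omega> omega_inf"
    by (rule scale_form_cancel[rotated]) (simp add: z_nonzero)
  then show ?thesis
    by (simp only:) (intro forms_intros subalgebra_V V_intros s_V z_V omega_inf_V)
qed

end


section \<open>The differential of the basis of the first cohomology\<close>

context superell_curve
begin

lemma t_ev_pderiv: "t * ev C (pderiv f) t = (\<Sum>m\<le>l. of_nat m * cst C (coeff f m) * t ^ m)"
proof -
  have coeff: "coeff (pCons 0 (pderiv f)) m = of_nat m * coeff f m" for m
    by (cases m) (simp_all add: coeff_pderiv)
  have "t * ev C (pderiv f) t = ev C (pCons 0 (pderiv f)) t"
    by (simp add: ev_pCons cst_homs)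
  also have "\<dots> = (\<Sum>m\<le>l. cst C (coeff (pCons 0 (pderiv f)) m) * t ^ m)"
    by (intro ev_altdef degree_le allI impI, subst coeff) (simp add: coeff_eq_0)
  also have "\<dots> = (\<Sum>m\<le>l. of_nat m * cst C (coeff f m) * t ^ m)"
    by (simp only: coeff cst_homs)
  finally show ?thesis .
qed

text \<open>
  The coefficients of \<open>(j/n) t f'(t) - i f(t)\<close>. The sum over \<open>m > i\<close> gives \<open>\<alpha>\<^sup>U\<close> and the sum over
  \<open>m \<le> i\<close> gives \<open>\<alpha>\<^sup>V\<close>, both with the common factor \<open>t\<^bsup>-i-1\<^esup> y\<^bsup>j-n\<^esup> dt\<close>.
\<close>

definition kappa :: "nat \<Rightarrow> nat \<Rightarrow> nat \<Rightarrow> 'K" where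
  "kappa i j m = cst C ((of_nat (j * m) - of_nat (i * n)) / of_nat n * coeff f m)"

lemma kappa_eq: "of_nat n * kappa i j m =
    of_nat j * (of_nat m * cst C (coeff f m)) - of_nat (i * n) * cst C (coeff f m)"
  using n_nonzero by (simp add: kappa_def cst_homs hom_divide[OF hom_cst] left_diff_distrib mult.assoc)

lemma dif_bas_h_sum:
  assumes "1 \<le> j" "j \<le> n - 1"
  shows "dif (bas_h C i j) =
    ((\<Sum>m\<le>l. kappa i j m * t ^ m) * s ^ (i + 1) * (y ^ (j - 1) / y ^ (n - 1))) *\<^sub>\<Omega> dif t"
proof -
  have h: "bas_h C i j = y ^ j * s ^ i"
    by (simp add: bas_h_def ss_def divide_inverse power_inverse)
  have ds: "dif (s ^ i) = (- (of_nat i * s ^ (i + 1))) *\<^sub>\<Omega> dif t"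
  proof (cases i)
    case (Suc i')
    then show ?thesis
      unfolding dif_power dif_s scale_form_scale by (simp add: power2_eq_square mult_ac)
  qed (simp add: dif_one)
  have "dif (bas_h C i j) = (y ^ j * (- (of_nat i * s ^ (i + 1))) +
      s ^ i * (of_nat j * y ^ (j - 1) * (ev C (pderiv f) t / (of_nat n * y ^ (n - 1))))) *\<^sub>\<Omega> dif t"
    unfolding h dif_mult ds dif_power[of y] dif_y scale_form_scale scale_form_add_left ..
  moreover have "y ^ j * (- (of_nat i * s ^ (i + 1))) +
      s ^ i * (of_nat j * y ^ (j - 1) * (ev C (pderiv f) t / (of_nat n * y ^ (n - 1)))) =
      (\<Sum>m\<le>l. kappa i j m * t ^ m) * s ^ (i + 1) * (y ^ (j - 1) / y ^ (n - 1))"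
  proof -
    have "of_nat n * (\<Sum>m\<le>l. kappa i j m * t ^ m) = (\<Sum>m\<le>l. (of_nat n * kappa i j m) * t ^ m)"
      by (simp add: sum_distrib_left mult.assoc)
    also have "\<dots> = of_nat j * (t * ev C (pderiv f) t) - of_nat (i * n) * ev C f t"
      unfolding kappa_eq t_ev_pderiv ev_altdef[of f l, OF order.refl]
      by (simp add: sum_distrib_left left_diff_distrib sum_subtractf mult.assoc)
    finally have sum: "(\<Sum>m\<le>l. kappa i j m * t ^ m) =
        (of_nat j * (t * ev C (pderiv f) t) - of_nat (i * n) * y ^ n) / of_nat n"
      using n_nonzero by (simp add: y_power field_simps)
    have yj: "y ^ j = y * y ^ (j - 1)" and yn: "y ^ n = y * y ^ (n - 1)"
      using assms n_Suc by (simp_all flip: power_Suc)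
    have si: "s ^ i = t * s ^ (i + 1)"
      using ts by (simp add: mult.assoc[symmetric])
    define Y where "Y = y ^ (n - 1)"
    have "Y \<noteq> 0" using y_nonzero by (simp add: Y_def)
    then show ?thesis
      unfolding sum yj yn si Y_def[symmetric] using n_nonzero
      by (simp add: field_simps del: power_Suc)
  qed
  ultimately show ?thesis by simp
qed

lemma alpha_U_sum:
  "alpha_U C i j =
    ((\<Sum>m=i+1..l. kappa i j m * t ^ m) * s ^ (i + 1) * (y ^ (j - 1) / y ^ (n - 1))) *\<^sub>\<Omega> dif t"
proof -
  have "(\<Sum>m=i+1..l. kappa i j m * t ^ (m - (i + 1))) =
      (\<Sum>m=i+1..l. kappa i j m * t ^ m) * s ^ (i + 1)"
    unfolding sum_distrib_right mult.assoc
    by (intro sum.cong refl arg_cong2[of _ _ _ _ "(*)"] t_s_power_ge[symmetric]) simp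
  then show ?thesis
    unfolding alpha_U_def kappa_def by simp
qed

lemma alpha_V_sum:
  assumes "1 \<le> j" "j \<le> n - 1"
  shows "alpha_V C i j =
    ((\<Sum>m=0..i. kappa i j m * t ^ m) * s ^ (i + 1) * (y ^ (j - 1) / y ^ (n - 1))) *\<^sub>\<Omega> dif t"
proof -
  \<comment> \<open>For \<open>m \<le> i\<close> this makes the exponent \<open>i + 1 + (n - j) r - 2 - m\<close> a true difference.\<close>
  have pos: "1 \<le> (n - j) * r"
    using mult_le_mono[of 1 "n - j" 1 r] r_pos assms by simp
  have z: "z ^ (j - 1) / z ^ (n - 1) * s ^ ((n - j) * r) = y ^ (j - 1) / y ^ (n - 1)"
  proof -
    have "n - 1 = (j - 1) + (n - j)" using assms by simp
    then have zn: "z ^ (n - 1) = z ^ (j - 1) * z ^ (n - j)"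
      and yn: "y ^ (n - 1) = y ^ (j - 1) * y ^ (n - j)"
      by (simp_all only: power_add)
    have "z ^ (n - j) = s ^ ((n - j) * r) * y ^ (n - j)"
      by (simp add: zz_def power_mult_distrib power_mult mult.commute[of "n - j"])
    then show ?thesis
      unfolding zn yn using z_nonzero s_nonzero y_nonzero by simp
  qed
  have "s ^ (i + 1 + (n - j) * r - 2 - m) * s ^ 2 = t ^ m * s ^ (i + 1) * s ^ ((n - j) * r)"
    if "m \<le> i" for m
  proof -
    have "t ^ m * s ^ (i + 1) * s ^ ((n - j) * r) = s ^ (i + 1 - m) * s ^ ((n - j) * r)"
      using that by (simp only: t_s_power_le)
    also have "\<dots> = s ^ (i + 1 + (n - j) * r - 2 - m) * s ^ 2"
      using that pos unfolding power_add[symmetric] by (intro arg_cong[of _ _ "\<lambda>e. s ^ e"]) linarith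
    finally show ?thesis ..
  qed
  then have "(\<Sum>m=0..i. kappa i j m * s ^ (i + 1 + (n - j) * r - 2 - m)) * s ^ 2 =
      (\<Sum>m=0..i. kappa i j m * t ^ m) * s ^ (i + 1) * s ^ ((n - j) * r)"
    unfolding sum_distrib_right mult.assoc by (intro sum.cong) simp_all
  note sum = this
  have neg: "cst C ((of_nat (i * n) - of_nat (j * m)) / of_nat n * coeff f m) = - kappa i j m" for m
    unfolding kappa_def cst_homs(5)[symmetric]
    by (metis minus_diff_eq minus_divide_left mult_minus_left)
  have "alpha_V C i j = ((\<Sum>m=0..i. - kappa i j m * s ^ (i + 1 + (n - j) * r - 2 - m))
      * z ^ (j - 1) / z ^ (n - 1) * (- (s ^ 2))) *\<^sub>\<Omega> dif t"
    unfolding alpha_V_def dif_s scale_form_scale neg ..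
  also have "(\<Sum>m=0..i. - kappa i j m * s ^ (i + 1 + (n - j) * r - 2 - m))
      * z ^ (j - 1) / z ^ (n - 1) * (- (s ^ 2)) =
      ((\<Sum>m=0..i. kappa i j m * s ^ (i + 1 + (n - j) * r - 2 - m)) * s ^ 2)
      * (z ^ (j - 1) / z ^ (n - 1))"
    by (simp add: sum_negf)
  finally show ?thesis
    unfolding sum z[symmetric] by (simp only: mult_ac)
qed

lemma dif_bas_h:
  assumes "1 \<le> j" "j \<le> n - 1"
  shows "dif (bas_h C i j) = alpha_U C i j + alpha_V C i j"
proof -
  have "(\<Sum>m\<le>l. kappa i j m * t ^ m) =
      (\<Sum>m=i+1..l. kappa i j m * t ^ m) + (\<Sum>m=0..i. kappa i j m * t ^ m)"
  proof -
    have zero: "kappa i j m = 0" if "l < m" for m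
      using that by (simp add: kappa_def coeff_eq_0 cst_homs)
    have "(\<Sum>m\<le>l. kappa i j m * t ^ m) = (\<Sum>m\<in>{i+1..l} \<union> {0..i}. kappa i j m * t ^ m)"
      by (rule sum.mono_neutral_left) (auto simp: zero not_le)
    also have "\<dots> = (\<Sum>m=i+1..l. kappa i j m * t ^ m) + (\<Sum>m=0..i. kappa i j m * t ^ m)"
      by (rule sum.union_disjoint) auto
    finally show ?thesis .
  qed
  then show ?thesis
    unfolding dif_bas_h_sum[OF assms] alpha_U_sum alpha_V_sum[OF assms]
    by (simp only: distrib_right scale_form_add_left)
qed

lemma alpha_U_form: "alpha_U C i j \<in> forms (O_Ubar C)"
  unfolding alpha_U_def divide_inverse power_inverse[symmetric]
  by (intro forms_intros subalgebra_Ubar Ubar_intros t_Ubar y_Ubar inverse_y_Ubar)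

lemma alpha_V_form: "alpha_V C i j \<in> forms (O_V C)"
proof -
  have "alpha_V C i j =
      ((\<Sum>m=0..i. cst C ((of_nat (i * n) - of_nat (j * m)) / of_nat n * coeff f m)
         * s ^ (i + 1 + (n - j) * r - 2 - m)) * z ^ (j - 1)) *\<^sub>\<Omega> omega_inf"
    by (simp only: alpha_V_def omega_inf_def scale_form_scale divide_inverse)
  then show ?thesis
    by (simp only:) (intro forms_intros subalgebra_V V_intros s_V z_V omega_inf_V)
qed


section \<open>Splitting of de Rham cohomology\<close>

definition coboundaries :: "'K set" where
  "coboundaries = {g + h | g h. g \<in> O_Ubar C \<and> h \<in> O_V C}"

lemma coboundaryI: "g \<in> O_Ubar C \<Longrightarrow> h \<in> O_V C \<Longrightarrow> g + h \<in> coboundaries"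
  unfolding coboundaries_def by blast

lemma coboundary_Ubar: "g \<in> O_Ubar C \<Longrightarrow> g \<in> coboundaries"
  and coboundary_V: "g \<in> O_V C \<Longrightarrow> g \<in> coboundaries"
  using coboundaryI[of g 0] coboundaryI[of 0 g] V_intros(4) Ubar_intros(4) by simp_all

lemma coboundaries_subgroup: "subgroup_of coboundaries"
proof (rule subgroup_ofI)
  fix x y assume "x \<in> coboundaries" "y \<in> coboundaries"
  then obtain g h g' h' where "x = g + h" "y = g' + h'" "g \<in> O_Ubar C" "h \<in> O_V C"
    "g' \<in> O_Ubar C" "h' \<in> O_V C"
    unfolding coboundaries_def by blast
  then show "x + y \<in> coboundaries"
    using coboundaryI[of "g + g'" "h + h'"] by (simp add: Ubar_intros V_intros add_ac)
next
  fix x assume "x \<in> coboundaries"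
  then obtain g h where "x = g + h" "g \<in> O_Ubar C" "h \<in> O_V C"
    unfolding coboundaries_def by blast
  then show "- x \<in> coboundaries"
    using coboundaryI[of "- g" "- h"] by (simp add: Ubar_intros V_intros)
qed (simp add: coboundary_V V_intros)

lemma coboundaries_scale:
  assumes "x \<in> coboundaries"
  shows "cst C a * x \<in> coboundaries"
proof -
  obtain g h where "x = g + h" "g \<in> O_Ubar C" "h \<in> O_V C"
    using assms unfolding coboundaries_def by blast
  then show ?thesis
    using coboundaryI[of "cst C a * g" "cst C a * h"] by (simp add: Ubar_intros V_intros distrib_left)
qed

lemma cls1_eq: "cls1 C = coset coboundaries"
  by (simp add: cls1_def coboundaries_def)

lemma H1_eq: "H1 C = quot_space (\<lambda>a g. cst C a * g) (O_UV C) coboundaries"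
  by (simp add: H1_def coboundaries_def)

lemma cls1_eq_iff: "cls1 C g = cls1 C h \<longleftrightarrow> g - h \<in> coboundaries"
  by (simp add: cls1_eq coset_eq_iff coboundaries_subgroup)

lemma H1_carrier: "carrier (H1 C) = cls1 C ` O_UV C"
  by (simp add: H1_eq cls1_eq quot_space_simps)

lemma H1_zero: "\<zero>\<^bsub>H1 C\<^esub> = coboundaries"
  by (simp add: H1_eq quot_space_simps)

lemma H1_add: "cls1 C g \<oplus>\<^bsub>H1 C\<^esub> cls1 C h = cls1 C (g + h)"
  by (simp add: H1_eq cls1_eq quot_space_add coboundaries_subgroup)

lemma H1_smult: "a \<odot>\<^bsub>H1 C\<^esub> cls1 C g = cls1 C (cst C a * g)"
  unfolding H1_eq cls1_eq
  by (rule quot_space_smult) (simp_all add: coboundaries_subgroup coboundaries_scale distrib_left)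

lemma H1_finsum:
  assumes "finite S" "\<And>m. m \<in> S \<Longrightarrow> g m \<in> O_UV C"
  shows "(\<Oplus>\<^bsub>H1 C\<^esub>m\<in>S. cls1 C (g m)) = cls1 C (\<Sum>m\<in>S. g m)"
  unfolding H1_eq cls1_eq
  by (rule quot_space_finsum) (simp_all add: assms coboundaries_subgroup subalgebra_UV subalgebra_subgroup)

lemma B_DR_subgroup: "subgroup_of (B_DR C)"
proof (rule subgroup_ofI)
  have "(0 :: 'K triple) = (dif 0, - dif 0, 0 + 0)"
    by (simp add: zero_prod_def)
  then show "0 \<in> B_DR C"
    unfolding B_DR_def using Ubar_intros(4) V_intros(4) by blast
next
  fix x y assume "x \<in> B_DR C" "y \<in> B_DR C"
  then obtain g h g' h' where *: "x = (dif g, - dif h, g + h)" "y = (dif g', - dif h', g' + h')"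
    "g \<in> O_Ubar C" "h \<in> O_V C" "g' \<in> O_Ubar C" "h' \<in> O_V C"
    unfolding B_DR_def by blast
  have "x + y = (dif (g + g'), - dif (h + h'), (g + g') + (h + h'))"
    by (simp add: * dif_add)
  then show "x + y \<in> B_DR C"
    unfolding B_DR_def using * Ubar_intros(2) V_intros(2) by blast
next
  fix x assume "x \<in> B_DR C"
  then obtain g h where *: "x = (dif g, - dif h, g + h)" "g \<in> O_Ubar C" "h \<in> O_V C"
    unfolding B_DR_def by blast
  have "- x = (dif (- g), - dif (- h), - g + - h)"
    by (simp add: * dif_minus)
  then show "- x \<in> B_DR C"
    unfolding B_DR_def using * Ubar_intros(7) V_intros(7) by blast
qed

lemma cls_DR_eq_iff: "cls_DR C x = cls_DR C x' \<longleftrightarrow> x - x' \<in> B_DR C"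
  by (simp add: cls_DR_def coset_eq_iff B_DR_subgroup)

lemma H1_DR_add: "cls_DR C x \<oplus>\<^bsub>H1_DR C\<^esub> cls_DR C x' = cls_DR C (x + x')"
  by (simp add: H1_DR_def cls_DR_def quot_space_add B_DR_subgroup)

lemma Z_DR_add: "x \<in> Z_DR C \<Longrightarrow> x' \<in> Z_DR C \<Longrightarrow> x + x' \<in> Z_DR C"
proof -
  assume "x \<in> Z_DR C" "x' \<in> Z_DR C"
  then obtain \<alpha> \<beta> g \<alpha>' \<beta>' g' where *: "x = (\<alpha>, \<beta>, g)" "x' = (\<alpha>', \<beta>', g')"
    "(\<alpha>, \<beta>, g) \<in> Z_DR C" "(\<alpha>', \<beta>', g') \<in> Z_DR C"
    by (cases x, cases x') auto
  have "\<beta> + \<beta>' - (\<alpha> + \<alpha>') + dif (g + g') = (\<beta> - \<alpha> + dif g) + (\<beta>' - \<alpha>' + dif g')"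
    by (simp only: dif_add algebra_simps)
  also have "\<dots> = 0"
    using *(3,4) by (simp add: Z_DR_def)
  finally have "\<beta> + \<beta>' - (\<alpha> + \<alpha>') + dif (g + g') = 0" .
  then show "x + x' \<in> Z_DR C"
    using *(3,4) unfolding *(1,2) by (simp add: Z_DR_def forms_add UV_intros)
qed

lemma Z_DR_scale:
  assumes "x \<in> Z_DR C"
  shows "scale_triple C a x \<in> Z_DR C"
proof -
  obtain \<alpha> \<beta> g where x: "x = (\<alpha>, \<beta>, g)" by (cases x)
  have "cst C a *\<^sub>\<Omega> (\<beta> - \<alpha> + dif g) = 0"
    using assms by (simp add: x Z_DR_def)
  then have "cst C a *\<^sub>\<Omega> \<beta> - cst C a *\<^sub>\<Omega> \<alpha> + dif (cst C a * g) = 0"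
    using scale_form_add_right[of "cst C a" \<beta> "- \<alpha>"]
    by (simp add: scale_form_add_right scale_form_minus_right dif_mult dif_cst)
  then show ?thesis
    using assms
    by (auto simp: x scale_triple_def Z_DR_def intro!: forms_scale subalgebra_Ubar subalgebra_V
        Ubar_intros V_intros UV_intros)
qed

text \<open>
  The map \<open>\<tau>\<close> is prescribed on the classes of the basis only. Because these classes span, \<open>\<tau>\<close> is a
  section of the projection of de Rham cocycles to the first cohomology of the structure sheaf.
\<close>

lemma tau_section:
  assumes \<tau>: "is_tau C \<tau>" and g: "g \<in> O_UV C"
  shows "\<tau> (cls1 C g) \<in> Z_DR C \<and> cls1 C (snd (snd (\<tau> (cls1 C g)))) = cls1 C g"
proof -
  have tau_add: "\<tau> (cls1 C (g + h)) = \<tau> (cls1 C g) + \<tau> (cls1 C h)"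
    if "g \<in> O_UV C" "h \<in> O_UV C" for g h
    using \<tau> that by (simp add: is_tau_def H1_carrier flip: H1_add)
  have tau_scale: "\<tau> (cls1 C (cst C a * g)) = scale_triple C a (\<tau> (cls1 C g))"
    if "g \<in> O_UV C" for a g
    using \<tau> that by (simp add: is_tau_def H1_carrier flip: H1_smult)
  have zero: "\<tau> (cls1 C g) = 0" if "g \<in> coboundaries" for g
  proof -
    have "cls1 C g = cls1 C 0" using that by (simp add: cls1_eq_iff)
    then show ?thesis using tau_add[of 0 0] by (simp add: UV_intros)
  qed
  have trivial: "\<tau> (cls1 C g) \<in> Z_DR C \<and> cls1 C (snd (snd (\<tau> (cls1 C g)))) = cls1 C g"
    if "g \<in> coboundaries" for g
    using that zero[OF that] subgroup_of_minus[OF coboundaries_subgroup that]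
    by (simp add: cls1_eq_iff Z_DR_def forms_zero UV_intros zero_prod_def)
  show ?thesis
    using g
  proof (induction rule: O_UV_induct)
    case (Ubar g)
    then show ?case by (intro trivial coboundary_Ubar)
  next
    case (V g)
    then show ?case by (intro trivial coboundary_V)
  next
    case (basis i j)
    then have "\<tau> (cls1 C (bas_h C i j)) = (alpha_U C i j, - alpha_V C i j, bas_h C i j)"
      using \<tau> unfolding is_tau_def by blast
    moreover have "bas_h C i j \<in> O_UV C"
    proof -
      have "bas_h C i j = y ^ j * s ^ i"
        by (simp add: bas_h_def ss_def divide_inverse power_inverse)
      then show ?thesis by (simp add: UV_intros y_UV s_UV)
    qed
    ultimately show ?case
      using basis dif_bas_h[of j i] alpha_U_form alpha_V_form subgroup_of_minus[OF forms_subgroup]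
      by (simp add: Z_DR_def subalgebra_V)
  next
    case (add g h)
    have eq: "\<tau> (cls1 C (g + h)) = \<tau> (cls1 C g) + \<tau> (cls1 C h)"
      by (rule tau_add[OF add(1,2)])
    show ?case
      unfolding eq using add by (simp add: Z_DR_add flip: H1_add)
  next
    case (scale a g)
    have eq: "\<tau> (cls1 C (cst C a * g)) = scale_triple C a (\<tau> (cls1 C g))"
      by (rule tau_scale[OF scale(1)])
    show ?case
      unfolding eq using scale Z_DR_scale[of "\<tau> (cls1 C g)" a]
      by (simp add: scale_triple_def split_def flip: H1_smult)
  qed
qed

text \<open>
  Subtracting \<open>\<tau>\<close> of the class of \<open>g\<close> from a cocycle with last component \<open>g\<close> leaves, up to a
  coboundary, a cocycle with last component \<open>0\<close>, which is a global differential. The second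
  component of a preimage under the identification is unique, because de Rham coboundaries have
  coboundaries of the structure sheaf as last components.
\<close>

theorem P1_cls_DR:
  assumes \<tau>: "is_tau C \<tau>" and Z: "(\<eta>U, \<eta>V, g) \<in> Z_DR C"
  shows "P1 C \<tau> (cls_DR C (\<eta>U, \<eta>V, g)) = cls1 C g"
proof -
  have g: "g \<in> O_UV C" using Z by (simp add: Z_DR_def)
  obtain \<alpha> \<beta> g' where \<tau>g: "\<tau> (cls1 C g) = (\<alpha>, \<beta>, g')" by (cases "\<tau> (cls1 C g)")
  have Z': "(\<alpha>, \<beta>, g') \<in> Z_DR C" and "g - g' \<in> coboundaries"
    using tau_section[OF \<tau> g] by (simp_all add: \<tau>g flip: cls1_eq_iff)
  then obtain gU gV where gUV: "g - g' = gU + gV" "gU \<in> O_Ubar C" "gV \<in> O_V C"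
    unfolding coboundaries_def by blast
  define \<omega> where "\<omega> = \<eta>U - \<alpha> - dif gU"
  have \<omega>': "\<omega> = \<eta>V - \<beta> + dif gV"
  proof -
    have "dif g - dif g' = dif gU + dif gV"
      by (simp add: gUV(1) flip: dif_diff dif_add)
    moreover have "\<eta>V - \<eta>U + dif g = 0" "\<beta> - \<alpha> + dif g' = 0"
      using Z Z' by (simp_all add: Z_DR_def)
    then have "\<eta>U = \<eta>V + dif g" "\<alpha> = \<beta> + dif g'"
      by (simp_all add: algebra_simps eq_neg_iff_add_eq_0)
    ultimately show ?thesis by (simp add: \<omega>_def algebra_simps)
  qed
  have "\<omega> \<in> forms (O_Ubar C)"
    unfolding \<omega>_def using Z Z' gUV(2)
    by (intro forms_intros subalgebra_Ubar) (simp_all add: Z_DR_def)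
  moreover have "\<omega> \<in> forms (O_V C)"
    unfolding \<omega>' using Z Z' gUV(3)
    by (intro forms_intros subalgebra_V) (simp_all add: Z_DR_def)
  ultimately have \<omega>: "\<omega> \<in> H0 C" by (simp add: H0_def)
  have "\<eta>U - (\<omega> + \<alpha>) = dif gU" by (simp add: \<omega>_def)
  moreover have "\<eta>V - (\<omega> + \<beta>) = - dif gV" by (simp add: \<omega>')
  ultimately have "(\<eta>U, \<eta>V, g) - ((\<omega>, \<omega>, 0) + (\<alpha>, \<beta>, g')) = (dif gU, - dif gV, gU + gV)"
    by (simp only: add_Pair diff_Pair gUV(1) add_0_left)
  then have "(\<eta>U, \<eta>V, g) - ((\<omega>, \<omega>, 0) + (\<alpha>, \<beta>, g')) \<in> B_DR C"
    using gUV(2,3) unfolding B_DR_def by blast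
  then have "cls_DR C (\<eta>U, \<eta>V, g) = cls_DR C ((\<omega>, \<omega>, 0) + (\<alpha>, \<beta>, g'))"
    by (simp only: cls_DR_eq_iff)
  then have "identify C \<tau> (\<omega>, cls1 C g) = cls_DR C (\<eta>U, \<eta>V, g)"
    by (simp only: identify_def case_prod_conv \<tau>g H1_DR_add)
  then have mem: "cls_DR C (\<eta>U, \<eta>V, g) \<in> identify C \<tau> ` (H0 C \<times> carrier (H1 C))"
    using \<omega> g unfolding H1_carrier by force
  \<comment> \<open>An arbitrary preimage, since \<^const>\<open>P1\<close> chooses one.\<close>
  define q where "q = inv_into (H0 C \<times> carrier (H1 C)) (identify C \<tau>) (cls_DR C (\<eta>U, \<eta>V, g))"
  have "q \<in> H0 C \<times> carrier (H1 C)" and q: "identify C \<tau> q = cls_DR C (\<eta>U, \<eta>V, g)"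
    using inv_into_into[OF mem] f_inv_into_f[OF mem] by (simp_all only: q_def)
  then obtain \<theta> g1 where q_eq: "q = (\<theta>, cls1 C g1)" and g1: "g1 \<in> O_UV C"
    unfolding H1_carrier by blast
  obtain \<alpha>1 \<beta>1 g1' where \<tau>g1: "\<tau> (cls1 C g1) = (\<alpha>1, \<beta>1, g1')" by (cases "\<tau> (cls1 C g1)")
  have "(\<theta>, \<theta>, 0) + (\<alpha>1, \<beta>1, g1') - (\<eta>U, \<eta>V, g) \<in> B_DR C"
    using q by (simp only: q_eq identify_def case_prod_conv \<tau>g1 H1_DR_add cls_DR_eq_iff)
  then have "g1' - g \<in> coboundaries"
    by (auto simp: B_DR_def coboundaries_def)
  then have "cls1 C g = cls1 C g1"
    using tau_section[OF \<tau> g1] by (simp add: \<tau>g1 cls1_eq_iff[symmetric])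
  then show ?thesis
    by (simp add: P1_def q_def[symmetric] q_eq)
qed

end


section \<open>Reduction of a class to the basis of the first cohomology\<close>

context superell_curve
begin

lemma monomial_Ubar: "m \<le> e \<Longrightarrow> t ^ e * s ^ m \<in> O_Ubar C"
  by (simp add: t_s_power_ge Ubar_intros t_Ubar)

text \<open>
  Among the terms \<open>v[e + m] s\<^sup>m y\<^sup>j\<close> of \<open>t\<^sup>e v(1/t) y\<^sup>j\<close>, those with \<open>m \<le> 0\<close> are regular on
  \<open>\<U>\<close> and, because \<open>y = s\<^bsup>-r\<^esup> z\<close>, those with \<open>m \<ge> r j\<close> are regular on \<open>\<V>\<close>.
\<close>

lemma ev_s_mod_coboundaries:
  "t ^ e * ev C v s * y ^ j - (\<Sum>m\<in>{1..r * j - 1}. cst C (coeff v (e + m)) * (y ^ j / t ^ m))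
    \<in> coboundaries"
proof -
  define N where "N = degree v + r * j"
  have s_eq: "y ^ j / t ^ m = s ^ m * y ^ j" for m
    by (simp add: ss_def divide_inverse power_inverse)
  have s_pos: "t ^ e * s ^ (m + e) = s ^ m" for m
    by (simp add: t_s_power_le)
  have "t ^ e * ev C v s = (\<Sum>m=0..e + N. cst C (coeff v m) * (t ^ e * s ^ m))"
    using ev_altdef[of v "e + N" s]
    by (simp add: N_def sum_distrib_left mult.left_commute atMost_atLeast0)
  also have "\<dots> = (\<Sum>m=0..e. cst C (coeff v m) * (t ^ e * s ^ m)) +
      (\<Sum>m=e + 1..e + N. cst C (coeff v m) * (t ^ e * s ^ m))"
    by (rule sum.ub_add_nat) simp
  also have "(\<Sum>m=e + 1..e + N. cst C (coeff v m) * (t ^ e * s ^ m)) =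
      (\<Sum>m=1..N. cst C (coeff v (e + m)) * s ^ m)"
    using sum.shift_bounds_cl_nat_ivl[of "\<lambda>m. cst C (coeff v m) * (t ^ e * s ^ m)" 1 e N]
    by (simp add: s_pos add.commute)
  also have "\<dots> = (\<Sum>m\<in>{1..r * j - 1}. cst C (coeff v (e + m)) * s ^ m) +
      (\<Sum>m\<in>{max 1 (r * j)..N}. cst C (coeff v (e + m)) * s ^ m)"
  proof -
    have "{1..N} = {1..r * j - 1} \<union> {max 1 (r * j)..N}" by (auto simp: N_def)
    then show ?thesis by (simp only:) (rule sum.union_disjoint, auto)
  qed
  finally have "t ^ e * ev C v s * y ^ j -
      (\<Sum>m\<in>{1..r * j - 1}. cst C (coeff v (e + m)) * (y ^ j / t ^ m)) =
      (\<Sum>m=0..e. cst C (coeff v m) * (t ^ e * s ^ m)) * y ^ j +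
      (\<Sum>m\<in>{max 1 (r * j)..N}. cst C (coeff v (e + m)) * (s ^ m * y ^ j))"
    by (simp add: s_eq algebra_simps sum_distrib_left)
  also have "\<dots> \<in> coboundaries"
  proof (rule coboundaryI)
    show "(\<Sum>m=0..e. cst C (coeff v m) * (t ^ e * s ^ m)) * y ^ j \<in> O_Ubar C"
      by (intro Ubar_intros monomial_Ubar y_Ubar) simp
    have "s ^ m * y ^ j \<in> O_V C" if "r * j \<le> m" for m
    proof -
      have "s ^ m * y ^ j = (t ^ (r * j) * s ^ m) * z ^ j"
        by (simp add: y_conv power_mult_distrib power_mult)
      then show ?thesis
        using that by (simp add: t_s_power_le V_intros s_V z_V)
    qed
    then show "(\<Sum>m\<in>{max 1 (r * j)..N}. cst C (coeff v (e + m)) * (s ^ m * y ^ j)) \<in> O_V C"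
      by (intro subalgebra_sum[OF subalgebra_V]
          subalgebra_mult[OF subalgebra_V subalgebra_cst[OF subalgebra_V]]) simp
  qed
  finally show ?thesis .
qed

text \<open>
  Since \<open>y\<^bsup>-n(a+1)\<^esup> = f\<^bsup>-(a+1)\<^esup>\<close>, replacing \<open>1/f\<close> by its approximation \<open>J\<close> changes the function
  by a multiple of \<open>t\<^bsup>e+d+1\<^esup> v(1/t)\<close>. The bound on \<open>deg v\<close> makes this a polynomial in \<open>t\<close>, so the
  change is regular on \<open>\<U>\<close>.
\<close>

theorem cls1_expansion:
  assumes inv: "monom 1 (d + 1) dvd f * J - 1" and deg: "degree v \<le> e + d" and b: "b \<le> n"
  shows "cls1 C (t ^ e * ev C v s / y ^ (n * a + b)) =
    (\<Oplus>\<^bsub>H1 C\<^esub>m\<in>{1..r * (n - b) - 1}.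
       (\<Sum>k=0..degree (J ^ (a + 1)). coeff (J ^ (a + 1)) k * coeff v (e + k + m))
         \<odot>\<^bsub>H1 C\<^esub> cls1 C (y ^ (n - b) / t ^ m))"
proof -
  define IP where "IP = J ^ (a + 1)"
  define j where "j = n - b"
  define Fa where "Fa = y ^ (n * (a + 1))"
  have Fa: "Fa \<noteq> 0" and Fa_ev: "Fa = ev C (f ^ (a + 1)) t"
    by (simp add: Fa_def y_nonzero) (simp only: Fa_def power_mult y_power ev_homs)
  have frac: "1 / y ^ (n * a + b) = y ^ j / Fa"
  proof -
    have "n * (a + 1) = (n * a + b) + j" using b by (simp add: j_def)
    then have "Fa = y ^ (n * a + b) * y ^ j" by (simp only: Fa_def power_add)
    then show ?thesis using y_nonzero by simp
  qed
  \<comment> \<open>The congruence \<open>f J = 1\<close> modulo \<open>t\<^bsup>d+1\<^esup>\<close> persists under powers.\<close>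
  have "f * J - 1 dvd (f * J) ^ (a + 1) - 1"
    using power_diff_1_eq[of "f * J" "a + 1"] by simp
  then have "monom 1 (d + 1) dvd f ^ (a + 1) * IP - 1"
    using inv dvd_trans unfolding IP_def power_mult_distrib by blast
  then obtain R where "f ^ (a + 1) * IP = 1 + monom 1 (d + 1) * R"
    by (metis add.commute diff_add_cancel dvdE)
  then have "ev C (f ^ (a + 1) * IP) t = ev C (1 + monom 1 (d + 1) * R) t" by simp
  then have IP: "Fa * ev C IP t = 1 + t ^ (d + 1) * ev C R t"
    unfolding Fa_ev by (simp only: ev_homs ev_monom cst_homs mult_1_left)
  define x where "x = t ^ e * ev C v s / y ^ (n * a + b)"
  define rest where "rest = t ^ (e + d + 1) * ev C v s * ev C R t * y ^ j * inverse y ^ (n * (a + 1))"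
  have "rest \<in> O_Ubar C"
  proof -
    define q where "q = t ^ (e + d + 1) * ev C v s"
    have "q =
        (\<Sum>m\<le>degree v. cst C (coeff v m) * (t ^ (e + d + 1) * s ^ m))"
      by (simp only: q_def ev_altdef[OF order.refl] sum_distrib_left mult.left_commute)
    also have "\<dots> \<in> O_Ubar C"
      using deg by (intro Ubar_intros monomial_Ubar) simp
    finally show ?thesis
      unfolding rest_def q_def[symmetric] by (intro Ubar_intros t_Ubar y_Ubar inverse_y_Ubar)
  qed
  have x_split: "x = ev C IP t * (t ^ e * ev C v s * y ^ j) - rest"
  proof -
    have "x = t ^ e * ev C v s * (1 / y ^ (n * a + b))" by (simp add: x_def)
    also have "\<dots> = (1 + t ^ (d + 1) * ev C R t) * (t ^ e * ev C v s * y ^ j) / Fa - rest"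
      unfolding frac rest_def power_inverse Fa_def[symmetric]
      by (simp add: power_add field_simps Fa)
    finally show ?thesis
      unfolding IP[symmetric] using Fa by simp
  qed
  define S where "S k = (\<Sum>m\<in>{1..r * j - 1}. cst C (coeff v (e + k + m)) * (y ^ j / t ^ m))" for k
  have IP_sum: "ev C IP t * (t ^ e * ev C v s * y ^ j) =
      (\<Sum>k=0..degree IP. cst C (coeff IP k) * (t ^ (e + k) * ev C v s * y ^ j))"
    unfolding ev_altdef[of IP "degree IP", OF order.refl] atMost_atLeast0 sum_distrib_right
    by (intro sum.cong) (simp_all add: power_add mult_ac)
  have "ev C IP t * (t ^ e * ev C v s * y ^ j) - (\<Sum>k=0..degree IP. cst C (coeff IP k) * S k) =
      (\<Sum>k=0..degree IP. cst C (coeff IP k) * (t ^ (e + k) * ev C v s * y ^ j - S k))"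
    by (simp add: IP_sum sum_subtractf right_diff_distrib)
  also have "\<dots> \<in> coboundaries"
    unfolding S_def
    by (intro subgroup_of_sum coboundaries_subgroup coboundaries_scale ev_s_mod_coboundaries)
  finally have "x - (\<Sum>k=0..degree IP. cst C (coeff IP k) * S k) \<in> coboundaries"
    unfolding x_split cancel_ab_semigroup_add_class.diff_right_commute[of _ rest]
    by (rule subgroup_of_diff[OF coboundaries_subgroup _ coboundary_Ubar[OF \<open>rest \<in> O_Ubar C\<close>]])
  moreover have "(\<Sum>k=0..degree IP. cst C (coeff IP k) * S k) =
      (\<Sum>m\<in>{1..r * j - 1}. cst C (\<Sum>k=0..degree IP. coeff IP k * coeff v (e + k + m)) * (y ^ j / t ^ m))"
    unfolding S_def cst_homs sum_distrib_left sum_distrib_right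
    by (subst sum.swap) (simp add: mult.assoc)
  ultimately have "cls1 C x = cls1 C (\<Sum>m\<in>{1..r * j - 1}.
      cst C (\<Sum>k=0..degree IP. coeff IP k * coeff v (e + k + m)) * (y ^ j / t ^ m))"
    by (simp only: cls1_eq_iff)
  also have "\<dots> = (\<Oplus>\<^bsub>H1 C\<^esub>m\<in>{1..r * j - 1}. cls1 C
      (cst C (\<Sum>k=0..degree IP. coeff IP k * coeff v (e + k + m)) * (y ^ j / t ^ m)))"
  proof (rule H1_finsum[symmetric])
    fix m
    have "y ^ j / t ^ m = y ^ j * s ^ m"
      by (simp add: ss_def divide_inverse power_inverse)
    then show "cst C (\<Sum>k=0..degree IP. coeff IP k * coeff v (e + k + m)) * (y ^ j / t ^ m) \<in> O_UV C"
      by (simp only:) (intro UV_intros y_UV s_UV)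
  qed simp
  finally show ?thesis
    by (simp only: x_def IP_def j_def H1_smult)
qed

end


section \<open>The Deligne--Illusie map\<close>

locale deligne_illusie = X: superell_curve C + X': superell_curve C'
  for C :: "('k::finite_field, 'K::field) superell" and C' :: "('k, 'L::field) superell" +
  fixes p :: nat and v :: "'k poly" and F :: "'L \<Rightarrow> 'K"
    and fU fV :: "'L kaehler \<Rightarrow> 'K kaehler" and h :: "'L kaehler \<Rightarrow> 'K"
  assumes prime: "prime p" and char: "CHAR('k) = p"
    and rr: "rr C' = rr C"
    and frob: "is_rel_Frobenius p C' C F"
    and maps: "are_DI_maps p v C' C F fU fV h"
begin

lemma hom_F: "is_ring_hom F" and F_cst: "F (cst C' a) = cst C a"
  and F_t: "F (tt C') = tt C ^ p" and F_y: "F (yy C') = yy C ^ p"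
  using frob by (auto simp: is_rel_Frobenius_def)

lemmas F_homs = homs[OF hom_F] hom_divide[OF hom_F]

lemma p_zero: "(of_nat p :: 'K) = 0"
proof -
  have "(of_nat p :: 'k) = 0" using char of_nat_CHAR by metis
  then have "cst C (of_nat p) = 0" by (simp add: X.cst_homs)
  then show ?thesis by (simp add: X.cst_homs)
qed

lemma dif_p: "dif (a ^ p :: 'K) = 0"
  using dif_p_power[OF p_zero, of a 1] by simp

lemma F_ev: "F (ev C' q x) = ev C q (F x)"
  by (simp add: X.ev_altdef[OF order.refl] X'.ev_altdef[OF order.refl] F_homs F_cst)

lemma F_ev2: "F (ev2 C' Q a b) = ev2 C Q (F a) (F b)"
  by (simp add: X.ev2_altdef X'.ev2_altdef F_homs F_ev)

lemma F_s: "F (ss C') = ss C ^ p"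
  using F_homs(10)[of 1 "tt C'"]
  by (simp add: ss_def F_homs F_t inverse_eq_divide power_divide)

lemma F_z: "F (zz C') = zz C ^ p"
  by (simp add: zz_def F_homs F_s F_y rr power_mult_distrib power_commutes flip: power_mult)
     (simp add: mult.commute)

lemma dif_zero_subalgebra: "X.subalgebra {x. dif x = 0}"
  by (auto simp: X.subalgebra_def X.dif_cst dif_add dif_mult)

text \<open>
  The image of \<open>F\<close> consists of expressions in \<open>p\<close>-th powers, so the differentials in the
  de Rham coboundary of \<open>F(g)\<close> vanish.
\<close>

lemma F_coboundary:
  assumes "g \<in> X'.coboundaries"
  shows "(0, 0, F g) \<in> B_DR C"
proof -
  obtain gU gV where g: "g = gU + gV" "gU \<in> O_Ubar C'" "gV \<in> O_V C'"
    using assms unfolding X'.coboundaries_def by blast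
  obtain Q N R where Q: "gU = ev2 C' Q (tt C') (yy C') / yy C' ^ N" and R: "gV = ev2 C' R (ss C') (zz C')"
    using g(2,3) unfolding O_Ubar_def O_V_def by blast
  have "F gU = ev2 C Q (tt C ^ p) (yy C ^ p) / (yy C ^ p) ^ N"
    by (simp add: Q F_homs F_ev2 F_t F_y)
  then have FU: "F gU = ev2 C Q (tt C ^ p) (yy C ^ p) * (inverse (yy C) ^ p) ^ N"
    by (simp add: divide_inverse power_inverse)
  have FV: "F gV = ev2 C R (ss C ^ p) (zz C ^ p)"
    by (simp add: R F_ev2 F_s F_z)
  have "F gU \<in> O_Ubar C" "F gV \<in> O_V C"
    unfolding FU FV
    by (intro X.Ubar_intros X.subalgebra_ev2 X.subalgebra_Ubar X.t_Ubar X.y_Ubar X.inverse_y_Ubar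
        X.subalgebra_V X.V_intros X.s_V X.z_V)+
  moreover have "F gU \<in> {x. dif x = 0}"
    unfolding FU
    by (rule X.subalgebra_mult[OF dif_zero_subalgebra X.subalgebra_ev2[OF dif_zero_subalgebra]
        X.subalgebra_power[OF dif_zero_subalgebra]]) (simp_all add: dif_p)
  moreover have "F gV \<in> {x. dif x = 0}"
    unfolding FV by (rule X.subalgebra_ev2[OF dif_zero_subalgebra]) (simp_all add: dif_p)
  ultimately have "dif (F gU) = 0" "dif (F gV) = 0" "F gU \<in> O_Ubar C" "F gV \<in> O_V C" by simp_all
  then have "(0, 0, F g) = (dif (F gU), - dif (F gV), F gU + F gV)"
    by (simp add: g(1) F_homs)
  then show ?thesis
    unfolding B_DR_def using \<open>F gU \<in> O_Ubar C\<close> \<open>F gV \<in> O_V C\<close> by blast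
qed

lemma fU_bas_om: "fU (bas_om C' i j) = ((tt C ^ i / yy C ^ j) ^ p * tt C ^ (p - 1)) *\<^sub>\<Omega> dif (tt C)"
proof -
  have "tt C' ^ i / yy C' ^ j = tt C' ^ i * inverse (yy C') ^ j"
    by (simp add: divide_inverse power_inverse)
  then have "tt C' ^ i / yy C' ^ j \<in> O_Ubar C'"
    by (simp only:) (intro X'.Ubar_intros X'.t_Ubar X'.inverse_y_Ubar)
  moreover have "dif (tt C') \<in> forms (O_Ubar C')"
    by (intro X'.forms_dif X'.subalgebra_Ubar X'.t_Ubar)
  ultimately have "fU (bas_om C' i j) = F (tt C' ^ i / yy C' ^ j) *\<^sub>\<Omega> tt C ^ (p - 1) *\<^sub>\<Omega> dif (tt C)"
    using maps unfolding bas_om_def are_DI_maps_def semilinear_on_def by simp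
  moreover have "F (tt C' ^ i / yy C' ^ j) = (tt C ^ i / yy C ^ j) ^ p"
    by (simp add: F_homs F_t F_y power_divide power_commutes flip: power_mult) (simp add: mult.commute)
  ultimately show ?thesis by (simp add: scale_form_scale)
qed

lemma h_bas_om: "h (bas_om C' i j) = (tt C ^ i / yy C ^ j * tt C ^ 2) ^ p * ev C v (ss C)"
proof -
  have "tt C' ^ i / yy C' ^ j = tt C' ^ i * inverse (yy C') ^ j"
    by (simp add: divide_inverse power_inverse)
  then have "tt C' ^ i / yy C' ^ j \<in> O_UV C'"
    by (simp only:) (intro X'.UV_intros X'.t_UV X'.inverse_y_UV)
  moreover have "dif (tt C') \<in> forms (O_UV C')"
    by (intro X'.forms_dif X'.subalgebra_UV X'.t_UV)
  ultimately have "h (bas_om C' i j) = F (tt C' ^ i / yy C' ^ j) * (tt C ^ (2 * p) * ev C v (ss C))"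
    using maps unfolding bas_om_def are_DI_maps_def semilinear_on_def by simp
  moreover have "F (tt C' ^ i / yy C' ^ j) = (tt C ^ i / yy C ^ j) ^ p"
    by (simp add: F_homs F_t F_y power_divide power_commutes flip: power_mult) (simp add: mult.commute)
  ultimately show ?thesis
    by (simp only: power_mult_distrib power_mult mult.assoc)
qed

text \<open>
  For \<open>j > 0\<close> the form is \<open>ds\<close> divided by \<open>z\<^sup>j\<close> up to a power of \<open>s\<close>, and \<open>z\<^bsup>-j\<^esup>\<close> is not regular on
  \<open>\<V>'\<close>. Semilinearity is applied to the product with \<open>z\<^sup>j\<close>, and the factor \<open>z\<^bsup>pj\<^esup>\<close> is then
  cancelled in the function field.
\<close>

lemma fV_bas_om:
  assumes ij: "i + 2 \<le> rr C * j" "j \<le> expo C' - 1"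
  shows "fV (bas_om C' i j) = (- ((tt C ^ i / yy C ^ j * tt C ^ 2) ^ p *
    (ss C ^ (p - 1) + ev C (pderiv v) (ss C)))) *\<^sub>\<Omega> dif (ss C)"
proof (rule scale_form_cancel)
  define e where "e = rr C * j - 2 - i"
  define \<eta> where "\<eta> = (ss C ^ (p - 1) + ev C (pderiv v) (ss C)) *\<^sub>\<Omega> dif (ss C)"
  have fV: "fV (a *\<^sub>\<Omega> \<omega>) = F a *\<^sub>\<Omega> fV \<omega>" if "a \<in> O_V C'" "\<omega> \<in> forms (O_V C')" for a \<omega>
    using maps that unfolding are_DI_maps_def semilinear_on_def by blast
  have ds: "dif (ss C') \<in> forms (O_V C')"
    by (intro X'.forms_dif X'.subalgebra_V X'.s_V)
  show "(zz C ^ j) ^ p \<noteq> 0" by (simp add: X.z_nonzero)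
  have "F (zz C' ^ j) *\<^sub>\<Omega> fV (bas_om C' i j) = fV (zz C' ^ j *\<^sub>\<Omega> bas_om C' i j)"
    using ij by (intro fV[symmetric] X'.V_intros X'.z_V X'.bas_om_V) (simp_all add: rr)
  also have "\<dots> = fV ((- (ss C' ^ e)) *\<^sub>\<Omega> dif (ss C'))"
    using X'.z_bas_om[of i j] ij by (simp add: rr e_def)
  also have "\<dots> = F (- (ss C' ^ e)) *\<^sub>\<Omega> fV (dif (ss C'))"
    by (intro fV ds X'.V_intros X'.s_V)
  also have "fV (dif (ss C')) = \<eta>"
    using maps by (simp add: are_DI_maps_def \<eta>_def)
  also have "F (- (ss C' ^ e)) = - ((ss C ^ e) ^ p)"
    by (simp add: F_homs F_s power_commutes flip: power_mult) (simp add: mult.commute)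
  also have "F (zz C' ^ j) = (zz C ^ j) ^ p"
    by (simp add: F_homs F_z power_commutes flip: power_mult) (simp add: mult.commute)
  also have "(ss C ^ e) ^ p = (zz C ^ j) ^ p * (tt C ^ i / yy C ^ j * tt C ^ 2) ^ p"
    unfolding e_def X.z_bas_om_coeff[OF ij(1), symmetric] by (simp only: power_mult_distrib)
  finally show "(zz C ^ j) ^ p *\<^sub>\<Omega> fV (bas_om C' i j) = (zz C ^ j) ^ p *\<^sub>\<Omega>
      (- ((tt C ^ i / yy C ^ j * tt C ^ 2) ^ p *
        (ss C ^ (p - 1) + ev C (pderiv v) (ss C)))) *\<^sub>\<Omega> dif (ss C)"
    by (simp only: \<eta>_def scale_form_scale mult_minus_right mult_minus_left mult.assoc)
qed

text \<open>
  With \<open>u = t\<^bsup>i+2\<^esup> y\<^bsup>-j\<^esup>\<close>, all three terms of the cocycle condition are multiples of \<open>u\<^sup>p ds\<close>: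
  \<open>f\<^sub>V\<close> contributes \<open>- (s\<^bsup>p-1\<^esup> + v'(s))\<close>, \<open>- f\<^sub>U\<close> contributes \<open>s\<^bsup>p-1\<^esup>\<close>, and \<open>d(u\<^sup>p v(s))\<close>
  contributes \<open>v'(s)\<close>.
\<close>

lemma DI_cocycle:
  assumes ij: "i + 2 \<le> rr C * j" "j \<le> expo C' - 1"
  shows "(fU (bas_om C' i j), fV (bas_om C' i j), h (bas_om C' i j)) \<in> Z_DR C"
proof -
  define w where "w = tt C ^ i / yy C ^ j"
  have "p \<noteq> 0" using prime by auto
  then have tp: "tt C ^ (p - 1) * tt C ^ 2 = (tt C ^ 2) ^ p * ss C ^ (p - 1)"
  proof -
    have "(tt C ^ 2) ^ p * ss C ^ (p - 1) = tt C ^ (2 * p) * ss C ^ (p - 1)"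
      by (simp only: power_mult)
    also have "\<dots> = tt C ^ (2 * p - (p - 1))"
      by (rule X.t_s_power_ge) simp
    also have "2 * p - (p - 1) = (p - 1) + 2" using \<open>p \<noteq> 0\<close> by simp
    finally show ?thesis by (simp only: power_add)
  qed
  have "fU (bas_om C' i j) = (- ((w * tt C ^ 2) ^ p * ss C ^ (p - 1))) *\<^sub>\<Omega> dif (ss C)"
    unfolding fU_bas_om w_def[symmetric] X.dif_t scale_form_scale
    by (simp only: mult_minus_right mult.assoc tp power_mult_distrib)
  moreover have "dif (h (bas_om C' i j)) = ((w * tt C ^ 2) ^ p * ev C (pderiv v) (ss C)) *\<^sub>\<Omega> dif (ss C)"
    unfolding h_bas_om w_def[symmetric]
    by (simp add: dif_mult[of "(w * tt C ^ 2) ^ p"] dif_p X.dif_ev scale_form_scale)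
  ultimately have "fV (bas_om C' i j) - fU (bas_om C' i j) + dif (h (bas_om C' i j)) = 0"
    unfolding fV_bas_om[OF ij] w_def[symmetric]
    by (simp only: scale_form_minus_left distrib_left scale_form_add_left) simp
  moreover have "bas_om C' i j \<in> forms (O_V C')"
    using ij by (intro X'.bas_om_V) (simp_all add: rr)
  then have "fU (bas_om C' i j) \<in> forms (O_Ubar C)" "fV (bas_om C' i j) \<in> forms (O_V C)"
    "h (bas_om C' i j) \<in> O_UV C"
    using maps X'.bas_om_Ubar[of i j] X'.bas_om_UV[of i j] unfolding are_DI_maps_def by blast+
  ultimately show ?thesis by (simp add: Z_DR_def)
qed

text \<open>
  The second argument contributes the Frobenius image of some representative of the zero class,
  and every such image is a de Rham coboundary.
\<close>

lemma DI_map_bas_om: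
  "DI_map C F fU fV h (bas_om C' i j, \<zero>\<^bsub>H1 C'\<^esub>) =
    cls_DR C (fU (bas_om C' i j), fV (bas_om C' i j), h (bas_om C' i j))"
proof -
  have "(SOME g. g \<in> X'.coboundaries) \<in> X'.coboundaries"
    using subgroup_of_zero[OF X'.coboundaries_subgroup] by (rule someI)
  then have "(0, 0, F (SOME g. g \<in> X'.coboundaries)) \<in> B_DR C"
    by (rule F_coboundary)
  then show ?thesis
    by (simp add: DI_map_def X'.H1_zero X.H1_DR_add X.cls_DR_eq_iff)
qed

theorem P1_DI_map:
  assumes "is_tau C \<tau>" "i + 2 \<le> rr C * j" "j \<le> expo C' - 1"
  shows "P1 C \<tau> (DI_map C F fU fV h (bas_om C' i j, \<zero>\<^bsub>H1 C'\<^esub>)) = cls1 C (h (bas_om C' i j))"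
  unfolding DI_map_bas_om by (rule X.P1_cls_DR[OF assms(1) DI_cocycle[OF assms(2,3)]])

end


section \<open>The divided Frobenius on global differentials\<close>

text \<open>Separability of \<open>f\<close> passes from \<open>W\<close> to \<open>k\<close>, and from \<open>f\<close> to its Frobenius twist.\<close>

lemma bezout_map_poly:
  assumes \<phi>: "is_ring_hom \<phi>" and "A * q + B * pderiv q = 1"
  shows "\<exists>A B. A * map_poly \<phi> q + B * pderiv (map_poly \<phi> q) = 1"
proof -
  have "map_poly \<phi> (A * q + B * pderiv q) = 1"
    using assms(2) by (simp add: hom_one[OF hom_map_poly[OF \<phi>]])
  then show ?thesis
    using \<phi> hom_map_poly[OF \<phi>] by (auto simp: hom_add hom_mult map_poly_pderiv)
qed

theorem proposition6p3:
  fixes p n l r i j d a b :: nat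
    and red :: "'w::idom \<Rightarrow> 'k::finite_field" and sig :: "'w \<Rightarrow> 'w"
    and ff ff2 :: "'w poly" and f f2 v c Id IP :: "'k poly"
    and C :: "('k, 'K::field) superell" and C' :: "('k, 'L::field) superell"
    and F :: "'L \<Rightarrow> 'K" and fU fV :: "'L kaehler \<Rightarrow> 'K kaehler" and h :: "'L kaehler \<Rightarrow> 'K"
    and \<tau> :: "'K set \<Rightarrow> 'K triple" and \<Phi> :: "'K kaehler \<times> 'K set \<Rightarrow> 'K triple set"
  assumes "prime p" and "CHAR('k) = p" and "is_Witt_ring p red sig"
    and "n \<ge> 1" and "coprime n p" and "l \<ge> 1" and "[int l = - 1] (mod int n)" and "\<not> p dvd l"
    and "r = (l + 1) div n"
    and "degree ff = l" and "\<exists>A B. A * ff + B * pderiv ff = 1"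
    and "ff2 = at_infty l ff"
    and "f = map_poly red ff" and "f2 = map_poly red ff2"
    and "degree f = l" and "poly f 0 \<noteq> 0"
    and "is_curve C" and "expo C = n" and "rr C = r" and "fpol C = f"
    and "is_curve C'" and "expo C' = n" and "rr C' = r" and "fpol C' = map_poly (\<lambda>x. x ^ p) f"
    and "times_p p red (v * pderiv f2 ^ p - of_nat n * (c * f2 ^ p))
           (ff2 ^ p - pcompose (map_poly sig ff2) (monom 1 p))"
    and "is_tau C \<tau>"
    and "is_rel_Frobenius p C' C F"
    and "are_DI_maps p v C' C F fU fV h"
    and "is_divided_Frobenius p C' C (DI_map C F fU fV h) \<Phi>"
    and "1 \<le> j" and "j \<le> n - 1" and "int i \<le> int (r * j) - 2"
    and "d = nat (max 0 (int (degree v) - 2 * int p))"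
    and "monom 1 (d + 1) dvd f * Id - 1"
    and "a = (p * j) div n" and "b = (p * j) mod n"
    and "IP = Id ^ (a + 1)"
  shows "1 \<le> b \<and> b \<le> n - 1 \<and>
    P1 C \<tau> (\<Phi> (bas_om C i j, \<zero>\<^bsub>H1 C\<^esub>)) = cls1 C (h (bas_om C' i j)) \<and>
    cls1 C (h (bas_om C' i j)) =
      (\<Oplus>\<^bsub>H1 C\<^esub>m\<in>{1..r * (n - b) - 1}.
         (\<Sum>k=0..degree IP. coeff IP k * coeff v (p * (i + 2) + k + m))
           \<odot>\<^bsub>H1 C\<^esub> cls1 C (yy C ^ (n - b) / tt C ^ m))"
proof -
  have red: "is_ring_hom red" using assms(3) by (simp add: is_Witt_ring_def)
  have "2 \<le> n" using assms by linarith
  have "int n dvd int l + 1"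
    using assms(7) by (simp add: cong_iff_dvd_diff)
  then have "n dvd l + 1"
    by (metis int_dvd_int_iff of_nat_1 of_nat_add)
  then have rn: "r * n = l + 1" using assms(9) by simp
  have n_unit: "(of_nat n :: 'k) \<noteq> 0"
  proof
    assume "(of_nat n :: 'k) = 0"
    then have "p dvd n" using assms(2) by (simp add: of_nat_eq_0_iff_char_dvd)
    then show False
      using assms(1,5) by (metis coprime_absorb_right not_prime_unit)
  qed
  have smooth: "\<exists>A B. A * f + B * pderiv f = 1"
    using assms(11) bezout_map_poly[OF red] unfolding assms(13) by blast
  have frob: "is_ring_hom (\<lambda>x :: 'k. x ^ p)"
    using assms(1,2) by (simp add: is_ring_hom_def freshmans_dream power_mult_distrib)
  have p_pos: "p \<noteq> 0" using assms(1) by auto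
  have deg': "degree (map_poly (\<lambda>x. x ^ p) f) = l"
    using assms(15) p_pos by (simp add: degree_map_poly)
  have f0: "coeff f 0 \<noteq> 0" using assms(16) by (simp add: poly_0_coeff_0)
  interpret X: superell_curve C
    by standard (use assms rn n_unit smooth f0 \<open>2 \<le> n\<close> in simp_all)
  interpret X': superell_curve C'
  proof
    show "\<exists>A B. A * fpol C' + B * pderiv (fpol C') = 1"
      using smooth bezout_map_poly[OF frob] assms(24) by auto
    show "coeff (fpol C') 0 \<noteq> 0"
      using f0 p_pos assms(24) by (simp add: coeff_map_poly)
  qed (use assms rn n_unit deg' \<open>2 \<le> n\<close> in simp_all)
  interpret deligne_illusie C C' p v F fU fV h
    by standard (use assms in simp_all)
  have ij: "i + 2 \<le> r * j" using assms(32) by linarith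
  have b_n: "b < n" using \<open>2 \<le> n\<close> assms(36) by simp
  have "b \<noteq> 0"
  proof
    assume "b = 0"
    then have "n dvd p * j" using assms(36) by auto
    then have "n dvd j" using assms(5) by (simp add: coprime_dvd_mult_right_iff)
    then show False using assms(30,31) \<open>2 \<le> n\<close> by (auto dest: dvd_imp_le)
  qed
  have "\<Phi> (bas_om C i j, \<zero>\<^bsub>H1 C\<^esub>) = DI_map C F fU fV h (bas_om C' i j, \<zero>\<^bsub>H1 C'\<^esub>)"
    using assms(18,19,29-31) ij unfolding is_divided_Frobenius_def by blast
  then have P1: "P1 C \<tau> (\<Phi> (bas_om C i j, \<zero>\<^bsub>H1 C\<^esub>)) = cls1 C (h (bas_om C' i j))"
    using P1_DI_map[of \<tau> i j] assms(19,22,26,31) ij by simp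
  have ab: "p * j = n * a + b"
    using assms(35,36) by simp
  have "h (bas_om C' i j) = tt C ^ (p * (i + 2)) * ev C v (ss C) / yy C ^ (n * a + b)"
  proof -
    have "(tt C ^ i / yy C ^ j * tt C ^ 2) ^ p = (tt C ^ (i + 2) / yy C ^ j) ^ p"
      by (simp only: power_add times_divide_eq_left)
    also have "\<dots> = tt C ^ (p * (i + 2)) / yy C ^ (n * a + b)"
      unfolding ab[symmetric] power_divide power_mult[symmetric] by (simp only: mult.commute)
    finally show ?thesis by (simp add: h_bas_om)
  qed
  moreover have "degree v \<le> p * (i + 2) + d"
  proof -
    have "2 * p \<le> p * (i + 2)" by simp
    moreover have "degree v \<le> 2 * p + d" using assms(33) by simp
    ultimately show ?thesis by linarith
  qed
  ultimately have "cls1 C (h (bas_om C' i j)) =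
      (\<Oplus>\<^bsub>H1 C\<^esub>m\<in>{1..r * (n - b) - 1}.
         (\<Sum>k=0..degree IP. coeff IP k * coeff v (p * (i + 2) + k + m))
           \<odot>\<^bsub>H1 C\<^esub> cls1 C (yy C ^ (n - b) / tt C ^ m))"
    using X.cls1_expansion[of d Id v "p * (i + 2)" b a] assms(18,19,20,34,37) b_n by simp
  then show ?thesis
    using P1 \<open>b \<noteq> 0\<close> b_n by simp
qed

end
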